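(* Every $\psi\in \mathfrak{dmr}_0$ satisfies the equation $[\psi(x,y),x]+[\psi(-x-y,y),-x-y]=0$.
   Context: $\mathbb{K}$ is a field of characteristic $0$. $A=\mathbb{K}\langle\langle x,y\rangle\rangle$ is the algebra of noncommutative formal power series with concatenation product, graded by $\deg x=\deg y=1$; $\varepsilon:A\to\mathbb{K}$ is the constant term. $\mathbb{L}(x,y)\subset A$ is the degree-completed free Lie algebra on $x,y$ (Lie series, with commutator bracket), and $\mathbb{L}^{\ge n}(x,y)$ is the subspace of Lie series with no terms of degree less than $n$. For $P\in A$ and $s,t\in A$ with zero constant term, $P(s,t)$ is the image of $P$ under the continuous algebra morphism $x\mapsto s$, $y\mapsto t$. $(P\mid w)$ is the coefficient of the word $w$ in $P$. Every $P\in A$ is uniquely written $P=\varepsilon(P)+P_xx+P_yy$ with $P_x,P_y\in A$. $\mathbb{K}\langle Y\rangle$ is the free associative algebra on generators $Y_i$ ($i\ge1$, $\deg Y_i=i$), with coproduct the algebra morphism given by $\Delta_*(Y_m)=Y_m\otimes 1+1\otimes Y_m-\sum_{r+s=m,\,r,s\ge1}Y_r\otimes Y_s$, extended continuously to the degree completion $\mathbb{K}\langle\langle Y\rangle\rangle$ (with values in the completed tensor square). The map $Y_m\mapsto x^{m-1}y$ identifies $\mathbb{K}\langle\langle Y\rangle\rangle$ with the subalgebra $\mathbb{K}\oplus Ay$ of $A$. Let $\pi_Y:A\to\mathbb{K}\oplus Ay$, $\pi_Y(P)=\varepsilon(P)+P_yy$. The regularization of $\alpha\in A$ is $\alpha_*:=\pi_Y(\alpha)+\sum_{n\ge1}\frac{(\alpha\mid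 x^{n-1}y)}{n}y^n\in\mathbb{K}\langle\langle Y\rangle\rangle$. Racinet's double shuffle Lie algebra is $\mathfrak{dmr}_0:=\{\psi\in\mathbb{L}^{\ge3}(x,y)\mid \Delta_*(\psi_* )=\psi_*\otimes1+1\otimes\psi_*\}$. *)

theory Defs
  imports Complex_Main
begin

section \<open>Noncommutative formal power series\<close>

text \<open>
  A series in noncommuting letters from \<open>'a\<close> with coefficients in \<open>'k\<close> is its coefficient function
  on words. Coefficients commute with letters, but \<open>'k\<close> itself need not be commutative: this is
  used below, where the completed tensor square is a ring of series with series as coefficients.
\<close>

typedef ('a, 'k) ncfps = "UNIV :: ('a list \<Rightarrow> 'k) set"
  morphisms coeff Abs_ncfps
  by simp

lemma coeff_Abs_ncfps [simp]: "coeff (Abs_ncfps f) w = f w"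
  by (simp add: Abs_ncfps_inverse)

lemma ncfps_eqI: "(\<And>w. coeff P w = coeff Q w) \<Longrightarrow> P = Q"
  by (metis coeff_inject ext)

instantiation ncfps :: (type, ring_1) ring_1
begin

definition "0 = Abs_ncfps (\<lambda>w. 0)"
definition "1 = Abs_ncfps (\<lambda>w. if w = [] then 1 else 0)"
definition "P + Q = Abs_ncfps (\<lambda>w. coeff P w + coeff Q w)"
definition "P - Q = Abs_ncfps (\<lambda>w. coeff P w - coeff Q w)"
definition "- P = Abs_ncfps (\<lambda>w. - coeff P w)"
definition "P * Q = Abs_ncfps (\<lambda>w. \<Sum>i\<le>length w. coeff P (take i w) * coeff Q (drop i w))"

instance
proof
  fix P Q R :: "('a, 'b) ncfps"
  show "P * Q * R = P * (Q * R)"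
  proof (rule ncfps_eqI)
    fix w :: "'a list"
    let ?n = "length w"
    let ?f = "\<lambda>i j. coeff P (take j w) * coeff Q (drop j (take i w)) * coeff R (drop i w)"
    have "coeff (P * Q * R) w = (\<Sum>i\<le>?n. \<Sum>j\<le>i. ?f i j)"
      by (auto simp: times_ncfps_def sum_distrib_right min_absorb1 min_absorb2 intro!: sum.cong)
    also have "\<dots> = (\<Sum>(i, j)\<in>Sigma {..?n} (\<lambda>i. {..i}). ?f i j)"
      by (simp add: sum.Sigma)
    also have "\<dots> = (\<Sum>(j, k)\<in>Sigma {..?n} (\<lambda>j. {..?n - j}). ?f (j + k) j)"
      by (rule sum.reindex_bij_witness[of _ "\<lambda>(j, k). (j + k, j)" "\<lambda>(i, j). (j, i - j)"]) auto
    also have "\<dots> = (\<Sum>j\<le>?n. \<Sum>k\<le>?n - j. ?f (j + k) j)"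
      by (simp add: sum.Sigma)
    also have "\<dots> = coeff (P * (Q * R)) w"
      by (simp add: times_ncfps_def sum_distrib_left mult.assoc drop_take add.commute)
    finally show "coeff (P * Q * R) w = coeff (P * (Q * R)) w" .
  qed
  show "1 * P = P"
  proof (rule ncfps_eqI)
    fix w :: "'a list"
    have "coeff (1 * P) w = (\<Sum>i\<le>length w. if i = 0 then coeff P w else 0)"
      unfolding times_ncfps_def one_ncfps_def coeff_Abs_ncfps by (rule sum.cong) auto
    then show "coeff (1 * P) w = coeff P w" by simp
  qed
  show "P * 1 = P"
  proof (rule ncfps_eqI)
    fix w :: "'a list"
    have "coeff (P * 1) w = (\<Sum>i\<le>length w. if i = length w then coeff P w else 0)"
      unfolding times_ncfps_def one_ncfps_def coeff_Abs_ncfps by (rule sum.cong) auto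
    then show "coeff (P * 1) w = coeff P w" by simp
  qed
  show "(0::('a, 'b) ncfps) \<noteq> 1"
  proof
    assume "(0::('a, 'b) ncfps) = 1"
    then have "coeff (0::('a, 'b) ncfps) [] = coeff 1 []" by simp
    then show False by (simp add: zero_ncfps_def one_ncfps_def)
  qed
qed (auto intro!: ncfps_eqI simp: zero_ncfps_def plus_ncfps_def minus_ncfps_def uminus_ncfps_def
  times_ncfps_def algebra_simps sum.distrib)

end

lemma coeff_simps [simp]:
  "coeff 0 w = 0"
  "coeff 1 w = (if w = [] then 1 else 0)"
  "coeff (P + Q) w = coeff P w + coeff Q w"
  "coeff (P - Q) w = coeff P w - coeff Q w"
  "coeff (- P) w = - coeff P w"
  by (simp_all add: zero_ncfps_def one_ncfps_def plus_ncfps_def minus_ncfps_def uminus_ncfps_def)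

lemma coeff_mult:
  "coeff (P * Q) w = (\<Sum>i\<le>length w. coeff P (take i w) * coeff Q (drop i w))"
  by (simp add: times_ncfps_def)

definition var :: "'a \<Rightarrow> ('a, 'k::ring_1) ncfps" where
  "var a = Abs_ncfps (\<lambda>w. if w = [a] then 1 else 0)"

definition smult :: "'k::ring_1 \<Rightarrow> ('a, 'k) ncfps \<Rightarrow> ('a, 'k) ncfps" where
  "smult c P = Abs_ncfps (\<lambda>w. c * coeff P w)"

definition const_term :: "('a, 'k) ncfps \<Rightarrow> 'k" where
  "const_term P = coeff P []"

definition lie_bracket :: "'r::ring \<Rightarrow> 'r \<Rightarrow> 'r" where
  "lie_bracket P Q = P * Q - Q * P"


section \<open>Lie series\<close>

text \<open>
  The free Lie algebra on the letters, realised as the Lie subalgebra they generate in the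
  algebra of series.
\<close>

inductive_set lie_polys :: "('a, 'k::field) ncfps set" where
  var: "var a \<in> lie_polys"
| add: "P \<in> lie_polys \<Longrightarrow> Q \<in> lie_polys \<Longrightarrow> P + Q \<in> lie_polys"
| smult: "P \<in> lie_polys \<Longrightarrow> smult c P \<in> lie_polys"
| bracket: "P \<in> lie_polys \<Longrightarrow> Q \<in> lie_polys \<Longrightarrow> lie_bracket P Q \<in> lie_polys"

definition hom_part :: "nat \<Rightarrow> ('a, 'k::zero) ncfps \<Rightarrow> ('a, 'k) ncfps" where
  "hom_part n P = Abs_ncfps (\<lambda>w. if length w = n then coeff P w else 0)"

definition lie_series :: "('a, 'k::field) ncfps set" where
  "lie_series = {P. \<forall>n. hom_part n P \<in> lie_polys}"

definition lie_series_ge :: "nat \<Rightarrow> ('a, 'k::field) ncfps set" where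
  "lie_series_ge n = {P \<in> lie_series. \<forall>w. length w < n \<longrightarrow> coeff P w = 0}"


section \<open>Series in two letters\<close>

datatype xy = LX | LY

abbreviation x_ser :: "(xy, 'k::ring_1) ncfps" where "x_ser \<equiv> var LX"
abbreviation y_ser :: "(xy, 'k::ring_1) ncfps" where "y_ser \<equiv> var LY"

definition word_eval :: "'r::monoid_mult \<Rightarrow> 'r \<Rightarrow> xy list \<Rightarrow> 'r" where
  "word_eval s t u = prod_list (map (case_xy s t) u)"

text \<open>
  \<open>subst_xy s t P\<close> is \<open>P(s, t)\<close>, the sum over all words \<open>u\<close> of \<open>(P | u)\<close> times the image of \<open>u\<close>. It is
  meaningful only for \<open>s\<close> and \<open>t\<close> without constant term. Then words longer than \<open>w\<close> contribute
  nothing to the coefficient of \<open>w\<close> (see \<open>coeff_word_eval_eq_0\<close>), so the sum below is the full one.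
\<close>

definition subst_xy ::
  "('a, 'k::field) ncfps \<Rightarrow> ('a, 'k) ncfps \<Rightarrow> (xy, 'k) ncfps \<Rightarrow> ('a, 'k) ncfps" where
  "subst_xy s t P =
    Abs_ncfps (\<lambda>w. \<Sum>u | length u \<le> length w. coeff P u * coeff (word_eval s t u) w)"

lemma finite_xy_words: "finite {u :: xy list. length u \<le> n}"
proof -
  have "finite (UNIV :: xy set)"
    by (rule finite_subset[of _ "{LX, LY}"]) (use xy.exhaust in auto)
  from finite_lists_length_le[OF this, of n] show ?thesis by simp
qed

lemma coeff_word_eval_eq_0:
  fixes s t :: "('a, 'k::ring_1) ncfps"
  assumes "const_term s = 0" "const_term t = 0" "length w < length u"
  shows "coeff (word_eval s t u) w = 0"
  using assms(3)
proof (induction u arbitrary: w)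
  case (Cons a u)
  let ?p = "case_xy s t a"
  have "coeff ?p (take i w) * coeff (word_eval s t u) (drop i w) = 0" if "i \<le> length w" for i
  proof (cases "i = 0")
    case True
    then show ?thesis using assms(1,2) by (cases a) (simp_all add: const_term_def)
  next
    case False
    then have "length (drop i w) < length u" using Cons.prems that by auto
    then show ?thesis using Cons.IH by simp
  qed
  then show ?case by (simp add: word_eval_def coeff_mult)
qed simp

text \<open>The components in the decomposition \<open>P = \<epsilon>(P) + P\<^sub>x x + P\<^sub>y y\<close>.\<close>

definition right_part :: "'a \<Rightarrow> ('a, 'k) ncfps \<Rightarrow> ('a, 'k) ncfps" where
  "right_part a P = Abs_ncfps (\<lambda>w. coeff P (w @ [a]))"

lemma coeff_mult_var_Nil [simp]: "coeff (P * var a) [] = 0"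
  by (simp add: coeff_mult var_def)

lemma coeff_mult_var_snoc [simp]:
  "coeff (P * var a) (w @ [b]) = (if a = b then coeff P w else 0)"
proof -
  have "coeff (P * var a) (w @ [b]) =
      (\<Sum>i\<le>Suc (length w). if i = length w then (if a = b then coeff P w else 0) else 0)"
    unfolding coeff_mult
  proof (rule sum.cong)
    fix i assume "i \<in> {..Suc (length w)}"
    then consider "i < length w" | "i = length w" | "i = Suc (length w)" by fastforce
    then show "coeff P (take i (w @ [b])) * coeff (var a) (drop i (w @ [b])) =
        (if i = length w then (if a = b then coeff P w else 0) else 0)"
      by cases (auto simp: var_def append_eq_Cons_conv)
  qed simp
  then show ?thesis by simp
qed

lemma right_decomposition:
  "P = smult (const_term P) 1 + right_part LX P * x_ser + right_part LY P * y_ser"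
proof (rule ncfps_eqI)
  fix w
  show "coeff P w =
      coeff (smult (const_term P) 1 + right_part LX P * x_ser + right_part LY P * y_ser) w"
  proof (cases w rule: rev_cases)
    case (snoc v a)
    then show ?thesis by (cases a) (simp_all add: smult_def right_part_def)
  qed (simp add: smult_def const_term_def)
qed

lemma right_decomposition_unique:
  assumes "P = smult c 1 + Q * x_ser + R * y_ser"
  shows "c = const_term P" "Q = right_part LX P" "R = right_part LY P"
  by (auto intro!: ncfps_eqI simp: assms smult_def const_term_def right_part_def)

definition \<pi>\<^sub>Y :: "(xy, 'k::field) ncfps \<Rightarrow> (xy, 'k) ncfps" where
  "\<pi>\<^sub>Y P = smult (const_term P) 1 + right_part LY P * y_ser"

text \<open>The series with terms \<open>(P | x^(n-1) y) / n \<sqdot> y^n\<close> for \<open>n \<ge> 1\<close>.\<close>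

definition corr_series :: "(xy, 'k::field_char_0) ncfps \<Rightarrow> (xy, 'k) ncfps" where
  "corr_series P = Abs_ncfps (\<lambda>w.
     let n = length w in
     if n \<ge> 1 \<and> w = replicate n LY
     then coeff P (replicate (n - 1) LX @ [LY]) / of_nat n else 0)"


section \<open>Series in the letters Y and the coproduct\<close>

text \<open>
  The letters \<open>Y_1, Y_2, \<dots>\<close> are encoded by natural numbers with a shift: \<open>k\<close> stands for \<open>Y_(k+1)\<close>.
  There are finitely many words of each degree, so the degree completion contains all series.
\<close>

type_synonym 'k yseries = "(nat, 'k) ncfps"

definition Y_ser :: "nat \<Rightarrow> 'k::ring_1 yseries" where
  "Y_ser m = var (m - 1)"

definition yweight :: "nat list \<Rightarrow> nat" where
  "yweight w = sum_list (map Suc w)"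

text \<open>
  The identification of \<open>\<bbbK> \<oplus> A y\<close> with series in the letters Y, under which \<open>x^(m-1) y\<close> becomes \<open>Y_m\<close>;
  \<open>to_yseries\<close> is only meant to be applied to elements of \<open>\<bbbK> \<oplus> A y\<close>.
\<close>

definition yword_to_xy :: "nat list \<Rightarrow> xy list" where
  "yword_to_xy w = concat (map (\<lambda>k. replicate k LX @ [LY]) w)"

definition to_yseries :: "(xy, 'k) ncfps \<Rightarrow> 'k yseries" where
  "to_yseries P = Abs_ncfps (\<lambda>w. coeff P (yword_to_xy w))"

definition reg :: "(xy, 'k::field_char_0) ncfps \<Rightarrow> 'k yseries" where
  "reg P = to_yseries (\<pi>\<^sub>Y P + corr_series P)"

text \<open>
  The completed tensor square consists of all functions on pairs of words. It is represented by
  series whose coefficients are series, the outer words being the left tensor factors. Since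
  outer letters commute with coefficients, the product is the one of the tensor square.
\<close>

type_synonym 'k ytensor = "(nat, 'k yseries) ncfps"

definition tensor :: "'k::ring_1 yseries \<Rightarrow> 'k yseries \<Rightarrow> 'k ytensor" where
  "tensor P Q = Abs_ncfps (\<lambda>u. smult (coeff P u) Q)"

definition coprod_gen :: "nat \<Rightarrow> 'k::ring_1 ytensor" where
  "coprod_gen m = tensor (Y_ser m) 1 + tensor 1 (Y_ser m)
     - (\<Sum>r = 1..<m. tensor (Y_ser r) (Y_ser (m - r)))"

definition coprod_word :: "nat list \<Rightarrow> 'k::ring_1 ytensor" where
  "coprod_word w = prod_list (map (\<lambda>k. coprod_gen (Suc k)) w)"

text \<open>
  The continuous extension is the sum over all words \<open>w\<close> of \<open>(P | w) \<Delta>\<^sub>*(w)\<close>. As \<open>\<Delta>\<^sub>*\<close> preserves degrees,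
  only words of degree \<open>deg u + deg v\<close> contribute to the coefficient of \<open>u \<otimes> v\<close>
  (see \<open>coeff_coprod_word_eq_0\<close>), and these are finite in number.
\<close>

definition coprod :: "'k::ring_1 yseries \<Rightarrow> 'k ytensor" where
  "coprod P = Abs_ncfps (\<lambda>u. Abs_ncfps (\<lambda>v.
     \<Sum>w | yweight w = yweight u + yweight v. coeff P w * coeff (coeff (coprod_word w) u) v))"

lemma finite_yweight: "finite {w. yweight w = n}"
proof (rule finite_subset)
  have len: "length w \<le> yweight w" for w
    by (induction w) (auto simp: yweight_def)
  have mem: "k \<in> set w \<Longrightarrow> k \<le> yweight w" for k w
    by (induction w) (auto simp: yweight_def)
  show "{w. yweight w = n} \<subseteq> {w. set w \<subseteq> {..n} \<and> length w \<le> n}"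
    using len mem by auto
qed (simp add: finite_lists_length_le)

lemma coeff_sum: "coeff (sum f I) w = (\<Sum>i\<in>I. coeff (f i) w)"
  by (induction I rule: infinite_finite_induct) auto

lemma coeff_tensor [simp]: "coeff (coeff (tensor P Q) u) v = coeff P u * coeff Q v"
  by (simp add: tensor_def smult_def)

lemma tensor_mult:
  fixes P Q P' Q' :: "'k::comm_ring_1 yseries"
  shows "tensor P Q * tensor P' Q' = tensor (P * P') (Q * Q')"
proof (intro ncfps_eqI)
  fix u v
  have "coeff (coeff (tensor P Q * tensor P' Q') u) v =
      (\<Sum>i\<le>length u. \<Sum>j\<le>length v.
        (coeff P (take i u) * coeff P' (drop i u)) * (coeff Q (take j v) * coeff Q' (drop j v)))"
    by (simp add: coeff_mult coeff_sum mult_ac)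
  also have "\<dots> = coeff (coeff (tensor (P * P') (Q * Q')) u) v"
    by (simp add: coeff_mult sum_product)
  finally show "coeff (coeff (tensor P Q * tensor P' Q') u) v =
      coeff (coeff (tensor (P * P') (Q * Q')) u) v" .
qed

lemma coeff_coprod_gen_eq_0:
  assumes "m \<ge> 1" "yweight u + yweight v \<noteq> m"
  shows "coeff (coeff (coprod_gen m :: 'k::ring_1 ytensor) u) v = 0"
proof -
  have Y: "coeff (Y_ser r :: 'k yseries) w = 0" if "r \<ge> 1" "yweight w \<noteq> r" for r w
    using that by (auto simp: Y_ser_def var_def yweight_def)
  have "coeff (Y_ser r :: 'k yseries) u * coeff (Y_ser (m - r)) v = 0" if "r \<in> {1..<m}" for r
    using that assms Y[of r u] Y[of "m - r" v] by (cases "yweight u = r") auto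
  moreover have "coeff (Y_ser m :: 'k yseries) u * coeff 1 v = 0"
    using assms Y[of m u] by (auto simp: yweight_def)
  moreover have "coeff (1 :: 'k yseries) u * coeff (Y_ser m) v = 0"
    using assms Y[of m v] by (auto simp: yweight_def)
  ultimately show ?thesis
    by (simp add: coprod_gen_def coeff_sum del: coeff_simps(2))
qed

lemma coeff_coprod_word_eq_0:
  assumes "yweight w \<noteq> yweight u + yweight v"
  shows "coeff (coeff (coprod_word w :: 'k::ring_1 ytensor) u) v = 0"
  using assms
proof (induction w arbitrary: u v)
  case Nil
  then show ?case by (auto simp: coprod_word_def yweight_def)
next
  case (Cons k w)
  have split: "yweight a = yweight (take i a) + yweight (drop i a)" for i a
    unfolding yweight_def by (metis append_take_drop_id map_append sum_list.append)
  have "coeff (coeff (coprod_gen (Suc k) :: 'k ytensor) (take i u)) (take j v) *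
      coeff (coeff (coprod_word w) (drop i u)) (drop j v) = 0" for i j
  proof (cases "yweight (take i u) + yweight (take j v) = Suc k")
    case True
    then have "yweight w \<noteq> yweight (drop i u) + yweight (drop j v)"
      using Cons.prems split[of u i] split[of v j] by (auto simp: yweight_def)
    then show ?thesis using Cons.IH by simp
  next
    case False
    then show ?thesis by (simp add: coeff_coprod_gen_eq_0)
  qed
  then show ?case by (simp add: coprod_word_def coeff_mult coeff_sum)
qed


section \<open>The double shuffle Lie algebra\<close>

definition dmr\<^sub>0 :: "(xy, 'k::field_char_0) ncfps set" where
  "dmr\<^sub>0 = {\<psi> \<in> lie_series_ge 3. coprod (reg \<psi>) = tensor (reg \<psi>) 1 + tensor 1 (reg \<psi>)}"

end

theory Submission
  imports Defs
begin

text \<open>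
  Put \<open>z = - x - y\<close> and let \<open>\<Theta>\<close> be the automorphism exchanging \<open>x\<close> and \<open>z\<close> and fixing \<open>y\<close>. Since
  \<open>1 - \<Sum> Y\<^sub>m t\<^sup>m = (1 - t x)\<^sup>-\<^sup>1 (1 + t z)\<close> is group-like for \<open>\<Delta>\<^sub>*\<close>, the antipode of \<open>\<Delta>\<^sub>*\<close> is
  \<open>Y\<^sub>m \<mapsto> (-1)\<^sup>m \<Theta>(Y\<^sub>m)\<close>, extended as an antiautomorphism. That it negates the primitive element \<open>\<psi>\<^sub>*\<close>
  means \<open>\<psi>\<^sub>y = \<Theta>(S(\<psi>\<^sub>y))\<close> up to a series in \<open>y\<close>, where \<open>S\<close> is the antipode of the shuffle Hopf algebra.
  As \<open>S(\<psi>) = - \<psi>\<close>, in terms of the letters \<open>x\<close> and \<open>z\<close> this says that the Lie series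
  \<open>E = [\<psi>, x] + [\<Theta>(\<psi>), z]\<close> has, in each degree \<open>n\<close>, the same coefficient at all words of the form \<open>x\<dots>z\<close>. All words in the shuffle product of
  \<open>xz\<close> and \<open>x\<^sup>n\<^sup>-\<^sup>3z\<close> have that form, so the common coefficient vanishes. As the words \<open>x\<dots>z\<close> include
  all Lyndon words of length at least two, \<open>E = 0\<close>.
\<close>

section \<open>Series\<close>

lemma coeff_smult [simp]: "coeff (smult c P) w = c * coeff P w"
  by (simp add: smult_def)

lemma coeff_var [simp]: "coeff (var a) w = (if w = [a] then 1 else 0)"
  by (simp add: var_def)

lemma coeff_hom_part [simp]: "coeff (hom_part n P) w = (if length w = n then coeff P w else 0)"
  by (simp add: hom_part_def)

lemma coeff_right_part [simp]: "coeff (right_part a P) w = coeff P (w @ [a])"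
  by (simp add: right_part_def)

lemma smult_mult_left: "smult c P * Q = smult c (P * Q)"
  by (rule ncfps_eqI) (simp add: coeff_mult sum_distrib_left mult.assoc)

lemma smult_mult_right: "P * smult (c::'k::comm_ring_1) Q = smult c (P * Q)"
  by (rule ncfps_eqI) (simp add: coeff_mult sum_distrib_left mult_ac)

lemma smult_smult: "smult c (smult d P) = smult (c * d) P"
  by (rule ncfps_eqI) (simp add: mult.assoc)

lemma smult_one [simp]: "smult 1 P = P"
  by (rule ncfps_eqI) simp

lemma smult_add_right: "smult c (P + Q) = smult c P + smult c Q"
  by (rule ncfps_eqI) (simp add: algebra_simps)

lemma smult_minus_one: "smult (- 1) P = - P"
  by (rule ncfps_eqI) simp

lemma coeff_mult_Nil [simp]: "coeff (P * Q) [] = coeff P [] * coeff Q []"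
  by (simp add: coeff_mult)

lemma coeff_mult_Cons:
  "coeff (P * Q) (a # w) = coeff P [] * coeff Q (a # w)
    + (\<Sum>i\<le>length w. coeff P (a # take i w) * coeff Q (drop i w))"
  by (simp add: coeff_mult sum.atMost_Suc_shift del: sum.atMost_Suc)

lemma coeff_var_mult_Cons [simp]:
  "coeff (var a * P) (b # w) = (if a = b then coeff P w else 0)"
proof -
  have "coeff (var a * P) (b # w)
      = (\<Sum>i\<le>length w. if i = 0 then (if a = b then coeff P w else 0) else 0)"
    unfolding coeff_mult_Cons coeff_var by (simp only: list.distinct if_False mult_zero_left add_0_left)
      (rule sum.cong, auto)
  then show ?thesis by simp
qed

lemma var_mult_left_cancel:
  assumes "var a * P = var a * Q"
  shows "P = Q"
proof (rule ncfps_eqI)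
  fix w
  have "coeff (var a * P) (a # w) = coeff (var a * Q) (a # w)" using assms by simp
  then show "coeff P w = coeff Q w" by simp
qed

lemma mult_var_right_cancel:
  assumes "P * var a = Q * var a"
  shows "P = Q"
  using assms by (metis coeff_mult_var_snoc ncfps_eqI)


section \<open>Substitution\<close>

lemma word_eval_Nil [simp]: "word_eval s t [] = 1"
  and word_eval_Cons: "word_eval s t (a # u) = case_xy s t a * word_eval s t u"
  and word_eval_append: "word_eval s t (u @ v) = word_eval s t u * word_eval s t v"
  by (simp_all add: word_eval_def)

lemma const_term_diff [simp]: "const_term (P - Q) = const_term P - const_term Q"
  and const_term_minus [simp]: "const_term (- P) = - const_term P"
  and const_term_var [simp]: "const_term (var a) = 0"
  by (simp_all add: const_term_def)

lemma coeff_subst_xy: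
  "coeff (subst_xy s t P) w = (\<Sum>u | length u \<le> length w. coeff P u * coeff (word_eval s t u) w)"
  by (simp add: subst_xy_def)

text \<open>Words longer than \<open>w\<close> contribute nothing, so the cutoff may be raised.
  Products and composites can then use one index set for all coefficients.\<close>

lemma coeff_subst_xy_le:
  assumes "const_term s = 0" "const_term t = 0" "length w \<le> n"
  shows "coeff (subst_xy s t P) w = (\<Sum>u | length u \<le> n. coeff P u * coeff (word_eval s t u) w)"
  unfolding coeff_subst_xy
  by (rule sum.mono_neutral_left)
    (use assms in \<open>auto simp: finite_xy_words not_le coeff_word_eval_eq_0\<close>)

lemma subst_xy_add: "subst_xy s t (P + Q) = subst_xy s t P + subst_xy s t Q"
  by (rule ncfps_eqI) (simp add: coeff_subst_xy sum.distrib algebra_simps)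

lemma subst_xy_smult: "subst_xy s t (smult c P) = smult c (subst_xy s t P)"
  by (rule ncfps_eqI) (simp add: coeff_subst_xy sum_distrib_left mult.assoc)

lemma subst_xy_minus: "subst_xy s t (- P) = - subst_xy s t P"
  by (simp add: smult_minus_one [symmetric] subst_xy_smult)

lemma subst_xy_diff: "subst_xy s t (P - Q) = subst_xy s t P - subst_xy s t Q"
  using subst_xy_add [of s t P "- Q"] by (simp add: subst_xy_minus)

lemma subst_xy_single:
  fixes s t :: "('a, 'k::field) ncfps"
  assumes "const_term s = 0" "const_term t = 0"
    and "\<And>u. u \<noteq> v \<Longrightarrow> coeff P u = 0"
  shows "subst_xy s t P = smult (coeff P v) (word_eval s t v)"
proof (rule ncfps_eqI)
  fix w :: "'a list"
  let ?n = "max (length w) (length v)"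
  have "coeff (subst_xy s t P) w = (\<Sum>u | length u \<le> ?n. coeff P u * coeff (word_eval s t u) w)"
    by (rule coeff_subst_xy_le) (use assms in auto)
  also have "\<dots> = (\<Sum>u | length u \<le> ?n. if u = v then coeff P v * coeff (word_eval s t v) w else 0)"
    by (rule sum.cong) (use assms(3) in auto)
  also have "\<dots> = coeff (smult (coeff P v) (word_eval s t v)) w"
    by (simp add: finite_xy_words)
  finally show "coeff (subst_xy s t P) w = coeff (smult (coeff P v) (word_eval s t v)) w" .
qed

lemma subst_xy_1:
  assumes "const_term s = 0" "const_term t = 0"
  shows "subst_xy s t 1 = 1"
  using subst_xy_single [OF assms, of "[]" 1] by simp

lemma subst_xy_var:
  assumes "const_term s = 0" "const_term t = 0"
  shows "subst_xy s t (var a) = case_xy s t a"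
  using subst_xy_single [OF assms, of "[a]" "var a"] by (simp add: word_eval_Cons)

text \<open>A word with a cut is a pair of words: \<open>(u, i)\<close> corresponds to
  \<open>(take i u, drop i u)\<close>.\<close>

lemma sum_split_words:
  fixes f :: "xy list \<Rightarrow> xy list \<Rightarrow> 'k::comm_monoid_add"
  shows "(\<Sum>u | length u \<le> n. \<Sum>i\<le>length u. f (take i u) (drop i u))
    = (\<Sum>p | length p \<le> n. \<Sum>q | length q \<le> n. if length p + length q \<le> n then f p q else 0)"
proof -
  let ?W = "{u :: xy list. length u \<le> n}"
  have fin: "finite ?W" by (rule finite_xy_words)
  have "(\<Sum>u\<in>?W. \<Sum>i\<le>length u. f (take i u) (drop i u))
      = (\<Sum>(u, i)\<in>Sigma ?W (\<lambda>u. {..length u}). f (take i u) (drop i u))"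
    using fin by (simp add: sum.Sigma)
  also have "\<dots> = (\<Sum>(p, q)\<in>{(p, q) \<in> ?W \<times> ?W. length p + length q \<le> n}. f p q)"
    by (rule sum.reindex_bij_witness[of _ "\<lambda>(p, q). (p @ q, length p)"
          "\<lambda>(u, i). (take i u, drop i u)"]) auto
  also have "\<dots> = (\<Sum>(p, q)\<in>?W \<times> ?W. if length p + length q \<le> n then f p q else 0)"
    by (rule sum.mono_neutral_cong_left) (use fin in \<open>auto split: if_splits\<close>)
  also have "\<dots> = (\<Sum>p\<in>?W. \<Sum>q\<in>?W. if length p + length q \<le> n then f p q else 0)"
    by (simp add: sum.cartesian_product)
  finally show ?thesis .
qed

lemma subst_xy_mult:
  fixes s t :: "('a, 'k::field) ncfps"
  assumes "const_term s = 0" "const_term t = 0"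
  shows "subst_xy s t (P * Q) = subst_xy s t P * subst_xy s t Q"
proof (rule ncfps_eqI)
  fix w :: "'a list"
  let ?n = "length w" and ?e = "word_eval s t"
  let ?W = "{u :: xy list. length u \<le> ?n}"
  have "coeff (subst_xy s t (P * Q)) w = (\<Sum>u\<in>?W. \<Sum>i\<le>length u.
      coeff P (take i u) * coeff Q (drop i u) * coeff (?e (take i u) * ?e (drop i u)) w)"
    by (simp add: coeff_subst_xy coeff_mult[of P Q] sum_distrib_right
        word_eval_append [symmetric] del: coeff_simps)
  also have "\<dots> = (\<Sum>p\<in>?W. \<Sum>q\<in>?W. if length p + length q \<le> ?n
      then coeff P p * coeff Q q * coeff (?e p * ?e q) w else 0)"
    by (rule sum_split_words)
  also have "\<dots> = (\<Sum>p\<in>?W. \<Sum>q\<in>?W. coeff P p * coeff Q q * coeff (?e p * ?e q) w)"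
    by (intro sum.cong refl)
      (auto simp: word_eval_append [symmetric] coeff_word_eval_eq_0 [OF assms])
  also have "\<dots> = (\<Sum>p\<in>?W. \<Sum>q\<in>?W. \<Sum>i\<le>?n.
      (coeff P p * coeff (?e p) (take i w)) * (coeff Q q * coeff (?e q) (drop i w)))"
    by (simp add: coeff_mult sum_distrib_left mult_ac)
  also have "\<dots> = (\<Sum>i\<le>?n. \<Sum>p\<in>?W. \<Sum>q\<in>?W.
      (coeff P p * coeff (?e p) (take i w)) * (coeff Q q * coeff (?e q) (drop i w)))"
    by (subst sum.swap[where A = "{..?n}"], intro sum.cong refl, rule sum.swap)
  also have "\<dots> = coeff (subst_xy s t P * subst_xy s t Q) w"
    by (simp add: coeff_mult sum_product coeff_subst_xy_le [OF assms, where n = ?n])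
  finally show "coeff (subst_xy s t (P * Q)) w = coeff (subst_xy s t P * subst_xy s t Q) w" .
qed

lemma subst_xy_word_eval:
  assumes "const_term s = 0" "const_term t = 0"
  shows "subst_xy s t (word_eval a b u) = word_eval (subst_xy s t a) (subst_xy s t b) u"
  by (induction u)
    (auto simp: subst_xy_1 [OF assms] subst_xy_mult [OF assms] word_eval_Cons split: xy.split)

lemma subst_xy_subst_xy:
  fixes s t :: "('a, 'k::field) ncfps"
  assumes "const_term s = 0" "const_term t = 0" "const_term a = 0" "const_term b = 0"
  shows "subst_xy s t (subst_xy a b P) = subst_xy (subst_xy s t a) (subst_xy s t b) P"
proof (rule ncfps_eqI)
  fix w :: "'a list"
  let ?W = "{u :: xy list. length u \<le> length w}"
  have "coeff (subst_xy s t (subst_xy a b P)) w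
      = (\<Sum>u\<in>?W. \<Sum>v\<in>?W. coeff P v * coeff (word_eval a b v) u * coeff (word_eval s t u) w)"
    unfolding coeff_subst_xy[of s t] sum_distrib_right [symmetric]
    by (intro sum.cong refl arg_cong2[where f = "(*)"] coeff_subst_xy_le) (use assms in auto)
  also have "\<dots> = (\<Sum>v\<in>?W. \<Sum>u\<in>?W. coeff P v * coeff (word_eval a b v) u * coeff (word_eval s t u) w)"
    by (rule sum.swap)
  also have "\<dots> = (\<Sum>v\<in>?W. coeff P v * coeff (subst_xy s t (word_eval a b v)) w)"
    by (simp add: coeff_subst_xy sum_distrib_left mult.assoc)
  also have "\<dots> = coeff (subst_xy (subst_xy s t a) (subst_xy s t b) P) w"
    by (simp add: subst_xy_word_eval assms coeff_subst_xy[of "subst_xy s t a"])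
  finally show "coeff (subst_xy s t (subst_xy a b P)) w
      = coeff (subst_xy (subst_xy s t a) (subst_xy s t b) P) w" .
qed

lemma case_xy_vars: "case_xy x_ser y_ser a = var a"
  by (cases a) auto

lemma coeff_word_eval_vars: "coeff (word_eval x_ser y_ser u) w = (if w = u then 1 else 0)"
proof (induction u arbitrary: w)
  case (Cons a u)
  then show ?case by (cases w) (auto simp: word_eval_Cons case_xy_vars)
qed simp

lemma subst_xy_vars: "subst_xy x_ser y_ser P = P"
  by (rule ncfps_eqI) (simp add: coeff_subst_xy coeff_word_eval_vars finite_xy_words if_distrib
      cong: if_cong)

text \<open>Substituting series of this kind preserves degree, so arguments can be carried out on
  homogeneous parts.\<close>

definition linear_form :: "('a, 'k::ring_1) ncfps \<Rightarrow> bool" where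
  "linear_form s \<longleftrightarrow> (\<forall>w. length w \<noteq> 1 \<longrightarrow> coeff s w = 0)"

lemma linear_form_var: "linear_form (var a)"
  and linear_form_minus: "linear_form s \<Longrightarrow> linear_form (- s)"
  and linear_form_diff: "linear_form s \<Longrightarrow> linear_form t \<Longrightarrow> linear_form (s - t)"
  and const_term_linear_form: "linear_form s \<Longrightarrow> const_term s = 0"
  by (auto simp: linear_form_def const_term_def)

lemma hom_part_linear_form_mult:
  assumes "linear_form s"
  shows "hom_part (Suc n) (s * P) = s * hom_part n P"
    and "hom_part (Suc n) (P * s) = hom_part n P * s"
proof -
  have *: "coeff s w = 0" if "length w \<noteq> 1" for w using assms that by (auto simp: linear_form_def)
  show "hom_part (Suc n) (s * P) = s * hom_part n P"
  proof (rule ncfps_eqI)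
    fix w
    have "coeff (s * hom_part n P) w = (\<Sum>i\<le>length w.
        if length w = Suc n then coeff s (take i w) * coeff P (drop i w) else 0)"
      unfolding coeff_mult by (rule sum.cong) (auto simp: * min_def)
    then show "coeff (hom_part (Suc n) (s * P)) w = coeff (s * hom_part n P) w"
      by (simp add: coeff_mult)
  qed
  show "hom_part (Suc n) (P * s) = hom_part n P * s"
  proof (rule ncfps_eqI)
    fix w
    have "coeff (hom_part n P * s) w = (\<Sum>i\<le>length w.
        if length w = Suc n then coeff P (take i w) * coeff s (drop i w) else 0)"
      unfolding coeff_mult by (rule sum.cong) (auto simp: * min_def)
    then show "coeff (hom_part (Suc n) (P * s)) w = coeff (hom_part n P * s) w"
      by (simp add: coeff_mult)
  qed
qed

lemma coeff_word_eval_linear_form: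
  assumes "linear_form s" "linear_form t" "length w \<noteq> length u"
  shows "coeff (word_eval s t u) w = 0"
  using assms(3)
proof (induction u arbitrary: w)
  case (Cons a u)
  have lin: "linear_form (case_xy s t a)" using assms by (cases a) auto
  have "coeff (word_eval s t (a # u)) w
      = coeff (hom_part (length w) (case_xy s t a * word_eval s t u)) w"
    by (simp add: word_eval_Cons)
  also have "\<dots> = 0"
  proof (cases w)
    case Nil
    then show ?thesis using const_term_linear_form [OF lin] by (simp add: const_term_def)
  next
    case (Cons b v)
    have "hom_part (length v) (word_eval s t u) = 0"
      using Cons.IH Cons.prems Cons by (intro ncfps_eqI) auto
    with Cons show ?thesis
      by (simp add: hom_part_linear_form_mult(1) [OF lin] del: coeff_hom_part)
  qed
  finally show ?case .
qed simp

lemma hom_part_subst_xy: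
  assumes "linear_form s" "linear_form t"
  shows "hom_part n (subst_xy s t P) = subst_xy s t (hom_part n P)"
proof (rule ncfps_eqI)
  fix w
  have "coeff (subst_xy s t (hom_part n P)) w = (\<Sum>u | length u \<le> length w.
      if length w = n then coeff P u * coeff (word_eval s t u) w else 0)"
    unfolding coeff_subst_xy
    by (rule sum.cong) (auto simp: coeff_word_eval_linear_form [OF assms])
  then show "coeff (hom_part n (subst_xy s t P)) w = coeff (subst_xy s t (hom_part n P)) w"
    by (simp add: coeff_subst_xy)
qed

section \<open>Shuffles and Lie series\<close>

text \<open>A list rather than a set, since the shuffle product counts repeated words with
  multiplicity.\<close>

fun shuffle_list :: "'a list \<Rightarrow> 'a list \<Rightarrow> 'a list list" where
  "shuffle_list [] v = [v]"
| "shuffle_list u [] = [u]"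
| "shuffle_list (a # u) (b # v)
    = map ((#) a) (shuffle_list u (b # v)) @ map ((#) b) (shuffle_list (a # u) v)"

lemma shuffle_list_Nil2 [simp]: "shuffle_list u [] = [u]"
  by (cases u) auto

text \<open>The linear extension of \<open>f\<close>, evaluated on the shuffle product of
  \<open>u\<close> and \<open>v\<close>.\<close>

definition shuffle_sum :: "('a list \<Rightarrow> 'k::comm_monoid_add) \<Rightarrow> 'a list \<Rightarrow> 'a list \<Rightarrow> 'k" where
  "shuffle_sum f u v = sum_list (map f (shuffle_list u v))"

lemma shuffle_sum_Nil [simp]: "shuffle_sum f [] v = f v" "shuffle_sum f u [] = f u"
  by (simp_all add: shuffle_sum_def)

lemma shuffle_sum_Cons:
  "shuffle_sum f (a # u) (b # v)
    = shuffle_sum (\<lambda>w. f (a # w)) u (b # v) + shuffle_sum (\<lambda>w. f (b # w)) (a # u) v"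
  by (simp add: shuffle_sum_def comp_def)

lemma shuffle_sum_add:
  "shuffle_sum (\<lambda>w. f w + g w) u v = shuffle_sum f u v + shuffle_sum g u v"
  by (simp add: shuffle_sum_def sum_list_addf)

lemma shuffle_sum_const_mult:
  fixes c :: "'k::semiring_0"
  shows "shuffle_sum (\<lambda>w. c * f w) u v = c * shuffle_sum f u v"
  by (simp add: shuffle_sum_def sum_list_const_mult)

lemma shuffle_sum_cong:
  "(\<And>w. w \<in> set (shuffle_list u v) \<Longrightarrow> f w = g w) \<Longrightarrow> shuffle_sum f u v = shuffle_sum g u v"
  unfolding shuffle_sum_def by (metis map_cong)

lemma length_shuffle_list: "w \<in> set (shuffle_list u v) \<Longrightarrow> length w = length u + length v"
  by (induction u v arbitrary: w rule: shuffle_list.induct) auto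

text \<open>Deconcatenation is a morphism for the shuffle product.\<close>

lemma shuffle_sum_mult:
  fixes P Q :: "('a, 'k::comm_ring_1) ncfps"
  shows "shuffle_sum (coeff (P * Q)) u v = (\<Sum>i\<le>length u. \<Sum>j\<le>length v.
    shuffle_sum (coeff P) (take i u) (take j v) * shuffle_sum (coeff Q) (drop i u) (drop j v))"
proof (induction "length u + length v" arbitrary: u v P)
  case 0
  then show ?case by simp
next
  case (Suc n)
  show ?case
  proof (cases u)
    case Nil
    then show ?thesis by (simp add: coeff_mult)
  next
    case u: (Cons a u')
    show ?thesis
    proof (cases v)
      case Nil
      then show ?thesis by (simp add: coeff_mult)
    next
      case v: (Cons b v')
      \<comment> \<open>\<open>L c\<close> removes a leading \<open>c\<close> from \<open>P\<close>.
        Shuffles and coefficients of products both recurse on the first letter, so the induction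
        hypothesis applies with \<open>L a\<close> and \<open>L b\<close> in place of
        \<open>P\<close>.\<close>
      define L where "L c = Abs_ncfps (\<lambda>w. coeff P (c # w))" for c
      have PQ: "coeff (P * Q) (c # w) = coeff P [] * coeff Q (c # w) + coeff (L c * Q) w" for c w
        by (simp add: coeff_mult_Cons L_def coeff_mult[of "Abs_ncfps _"])
      have L: "(\<lambda>w. coeff P (c # w)) = coeff (L c)" for c by (simp add: L_def fun_eq_iff)
      have "shuffle_sum (coeff (P * Q)) u v = coeff P [] * shuffle_sum (coeff Q) u v
          + shuffle_sum (coeff (L a * Q)) u' v + shuffle_sum (coeff (L b * Q)) u v'"
        by (simp add: u v shuffle_sum_Cons PQ shuffle_sum_add shuffle_sum_const_mult algebra_simps)
      also have "shuffle_sum (coeff (L a * Q)) u' v = (\<Sum>i\<le>length u'. \<Sum>j\<le>length v.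
          shuffle_sum (coeff (L a)) (take i u') (take j v)
            * shuffle_sum (coeff Q) (drop i u') (drop j v))"
        using Suc u v by (intro Suc.hyps(1)) auto
      also have "shuffle_sum (coeff (L b * Q)) u v' = (\<Sum>i\<le>length u. \<Sum>j\<le>length v'.
          shuffle_sum (coeff (L b)) (take i u) (take j v')
            * shuffle_sum (coeff Q) (drop i u) (drop j v'))"
        using Suc u v by (intro Suc.hyps(1)) auto
      finally show ?thesis
        by (simp add: u v sum.atMost_Suc_shift shuffle_sum_Cons sum.distrib algebra_simps
            del: sum.atMost_Suc flip: L)
    qed
  qed
qed

section \<open>Shuffle relations and reversal for Lie polynomials\<close>

lemma const_term_lie_poly: "P \<in> lie_polys \<Longrightarrow> const_term P = 0"
  by (induction rule: lie_polys.induct) (auto simp: const_term_def lie_bracket_def)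

text \<open>Each factor vanishes if its two words are both empty or both nonempty. Only the cuts
  giving all of \<open>u\<close> to one factor and all of \<open>v\<close> to the other survive. The
  result is symmetric in \<open>P\<close> and \<open>Q\<close>, hence cancels in their
  bracket.\<close>

lemma shuffle_sum_mult_primitive:
  fixes P Q :: "('a, 'k::comm_ring_1) ncfps"
  assumes P: "\<And>u v. u \<noteq> [] \<Longrightarrow> v \<noteq> [] \<Longrightarrow> shuffle_sum (coeff P) u v = 0" "coeff P [] = 0"
    and Q: "\<And>u v. u \<noteq> [] \<Longrightarrow> v \<noteq> [] \<Longrightarrow> shuffle_sum (coeff Q) u v = 0" "coeff Q [] = 0"
    and uv: "u \<noteq> []" "v \<noteq> []"
  shows "shuffle_sum (coeff (P * Q)) u v = coeff P u * coeff Q v + coeff P v * coeff Q u"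
proof -
  let ?f = "\<lambda>i j. shuffle_sum (coeff P) (take i u) (take j v)
    * shuffle_sum (coeff Q) (drop i u) (drop j v)"
  have "?f i j = (if i = length u then if j = 0 then coeff P u * coeff Q v else 0 else 0)
      + (if i = 0 then if j = length v then coeff P v * coeff Q u else 0 else 0)"
    if "i \<le> length u" "j \<le> length v" for i j
  proof -
    consider "i = 0" "j = 0" | "i = 0" "0 < j" | "0 < i" "j = 0" | "0 < i" "0 < j" by blast
    then show ?thesis
    proof cases
      case 2
      show ?thesis
      proof (cases "j = length v")
        case False
        then have "drop j v \<noteq> []" using that by simp
        then show ?thesis using 2 False uv Q by simp
      qed (use 2 uv in simp)
    next
      case 3
      show ?thesis
      proof (cases "i = length u")
        case False
        then have "drop i u \<noteq> []" using that by simp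
        then show ?thesis using 3 False uv Q by simp
      qed (use 3 uv in simp)
    qed (use uv P in auto)
  qed
  then have "shuffle_sum (coeff (P * Q)) u v = (\<Sum>i\<le>length u. \<Sum>j\<le>length v.
      (if i = length u then if j = 0 then coeff P u * coeff Q v else 0 else 0)
      + (if i = 0 then if j = length v then coeff P v * coeff Q u else 0 else 0))"
    unfolding shuffle_sum_mult by (intro sum.cong refl) auto
  moreover have "(\<Sum>j\<le>length v. if c then g j else 0) = (if c then \<Sum>j\<le>length v. g j else 0)"
    for c and g :: "nat \<Rightarrow> 'k" by simp
  ultimately show ?thesis by (simp add: sum.distrib)
qed

text \<open>The easy half of Ree's criterion: a letter vanishes on words of length at least two, and
  brackets follow from the symmetry in \<open>shuffle_sum_mult_primitive\<close>.\<close>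

lemma lie_poly_shuffle_sum:
  assumes "P \<in> lie_polys" "u \<noteq> []" "v \<noteq> []"
  shows "shuffle_sum (coeff P) u v = 0"
  using assms
proof (induction arbitrary: u v rule: lie_polys.induct)
  case (var a)
  have "coeff (var a) w = 0" if "w \<in> set (shuffle_list u v)" for w
    using length_shuffle_list[OF that] var by (cases u; cases v) auto
  then have "shuffle_sum (coeff (var a)) u v = shuffle_sum (\<lambda>_. 0) u v"
    by (intro shuffle_sum_cong)
  then show ?case by (simp add: shuffle_sum_def del: coeff_var)
next
  case (add P Q)
  have "coeff (P + Q) = (\<lambda>w. coeff P w + coeff Q w)" by auto
  with add show ?case by (simp add: shuffle_sum_add)
next
  case (smult P c)
  have "coeff (smult c P) = (\<lambda>w. c * coeff P w)" by auto
  with smult show ?case by (simp add: shuffle_sum_const_mult)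
next
  case (bracket P Q)
  have 0: "coeff P [] = 0" "coeff Q [] = 0"
    using bracket.hyps const_term_lie_poly by (auto simp: const_term_def)
  have "coeff (lie_bracket P Q) = (\<lambda>w. coeff (P * Q) w + (- 1) * coeff (Q * P) w)"
    by (auto simp: lie_bracket_def)
  then have "shuffle_sum (coeff (lie_bracket P Q)) u v
      = shuffle_sum (coeff (P * Q)) u v + (- 1) * shuffle_sum (coeff (Q * P)) u v"
    by (simp only: shuffle_sum_add shuffle_sum_const_mult)
  with bracket 0 show ?case by (simp add: shuffle_sum_mult_primitive)
qed

lemma coeff_mult_rev:
  fixes P Q :: "('a, 'k::comm_ring_1) ncfps"
  shows "coeff (P * Q) (rev w)
    = (\<Sum>i\<le>length w. coeff Q (rev (take i w)) * coeff P (rev (drop i w)))"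
proof -
  have "coeff (P * Q) (rev w)
      = (\<Sum>i\<le>length w. coeff P (rev (drop (length w - i) w)) * coeff Q (rev (take (length w - i) w)))"
    by (simp add: coeff_mult take_rev drop_rev)
  also have "\<dots> = (\<Sum>i\<le>length w. coeff Q (rev (take i w)) * coeff P (rev (drop i w)))"
    by (rule sum.reindex_bij_witness[of _ "\<lambda>i. length w - i" "\<lambda>i. length w - i"])
      (auto simp: mult.commute)
  finally show ?thesis .
qed

text \<open>Reversal with the sign \<open>(- 1) ^ length w\<close> is an antiautomorphism of the
  concatenation product that negates letters; hence it also negates the bracket of two elements that
  it negates.\<close>

lemma lie_poly_rev:
  assumes "P \<in> lie_polys"
  shows "coeff P (rev w) = (- 1) ^ (length w + 1) * coeff P w"
  using assms
proof (induction arbitrary: w rule: lie_polys.induct)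
  case (bracket P Q)
  have mult: "coeff (P * Q) (rev w) = (- 1) ^ length w * coeff (Q * P) w"
    if "\<And>w. coeff P (rev w) = (- 1) ^ (length w + 1) * coeff P w"
      "\<And>w. coeff Q (rev w) = (- 1) ^ (length w + 1) * coeff Q w" for P Q :: "('a, 'b) ncfps"
  proof -
    have "(- 1) ^ i * (- 1) ^ (length w - i) = ((- 1) ^ length w :: 'b)" if "i \<le> length w" for i
      using that by (simp flip: power_add)
    then show ?thesis
      unfolding coeff_mult_rev that coeff_mult[of Q] sum_distrib_left
      by (intro sum.cong refl) (auto simp: min_def algebra_simps)
  qed
  have "coeff (P * Q) (rev w) = (- 1) ^ length w * coeff (Q * P) w"
    "coeff (Q * P) (rev w) = (- 1) ^ length w * coeff (P * Q) w"
    by (intro mult bracket.IH)+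
  then show ?case by (simp add: lie_bracket_def algebra_simps)
qed (auto simp: algebra_simps)

section \<open>Words whose coefficients determine a Lie polynomial\<close>

lemma last_shuffle_list:
  "w \<in> set (shuffle_list u v) \<Longrightarrow> u \<noteq> [] \<Longrightarrow> v \<noteq> [] \<Longrightarrow> last w = last u \<or> last w = last v"
proof (induction u v arbitrary: w rule: shuffle_list.induct)
  case (3 a u b v)
  then consider s where "w = a # s" "s \<in> set (shuffle_list u (b # v))"
    | s where "w = b # s" "s \<in> set (shuffle_list (a # u) v)" by auto
  then show ?case
  proof cases
    case 1
    then have "s \<noteq> []" using length_shuffle_list[OF 1(2)] by auto
    then show ?thesis using 1 3 by (cases "u = []") auto
  next
    case 2
    then have "s \<noteq> []" using length_shuffle_list[OF 2(2)] by auto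
    then show ?thesis using 2 3 by (cases "v = []") auto
  qed
qed auto

text \<open>Inserting \<open>a\<close> before any of the \<open>i\<close> leading letters always
  gives the same word; every other insertion falls into \<open>w\<close>.\<close>

lemma shuffle_sum_replicate:
  fixes f :: "'a list \<Rightarrow> 'k::semiring_1"
  shows "shuffle_sum f [a] (replicate i a @ w)
    = of_nat i * f (replicate (Suc i) a @ w) + shuffle_sum (\<lambda>s. f (replicate i a @ s)) [a] w"
proof (induction i arbitrary: f)
  case (Suc i)
  show ?case
    by (simp add: shuffle_sum_Cons Suc algebra_simps)
qed simp

text \<open>Shuffling \<open>a\<close> into \<open>a\<^sup>i b v\<close> expresses \<open>a\<^sup>i\<^sup>+\<^sup>1 b v\<close> by words with fewer initial letters \<open>a\<close>.\<close>

lemma coeff_eq_0_if_shuffle_letter: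
  fixes f :: "'a list \<Rightarrow> 'k::field_char_0"
  assumes shuffle: "\<And>w. w \<noteq> [] \<Longrightarrow> shuffle_sum f [a] w = 0"
    and base: "\<And>w. length w = n \<Longrightarrow> hd w = b \<Longrightarrow> last w = a \<Longrightarrow> f w = 0"
    and "a \<noteq> b" "length v + Suc i = n" "v \<noteq> []" "last v = a"
  shows "f (replicate i a @ b # v) = 0"
  using assms(4-)
proof (induction i arbitrary: v)
  case 0
  then show ?case using base[of "b # v"] by simp
next
  case (Suc i)
  \<comment> \<open>\<open>s\<close> still ends in \<open>a\<close>, since both shuffled words
    do.\<close>
  have "f (replicate i a @ b # s) = 0" if "s \<in> set (shuffle_list [a] v)" for s
    using Suc.prems length_shuffle_list[OF that] last_shuffle_list[OF that]
    by (intro Suc.IH) auto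
  then have "shuffle_sum (\<lambda>s. f (replicate i a @ b # s)) [a] v = shuffle_sum (\<lambda>_. 0) [a] v"
    by (rule shuffle_sum_cong)
  also have "\<dots> = 0" by (simp add: shuffle_sum_def)
  finally have 0: "shuffle_sum (\<lambda>s. f (replicate i a @ b # s)) [a] v = 0" .
  \<comment> \<open>Besides the \<open>i\<close> insertions among the leading letters, the one
    directly before \<open>b\<close> gives the same word. The factor \<open>Suc i\<close> is
    invertible in characteristic zero.\<close>
  have "0 = shuffle_sum f [a] (replicate i a @ b # v)" using shuffle by simp
  also have "\<dots> = of_nat (Suc i) * f (replicate (Suc i) a @ b # v)"
    unfolding shuffle_sum_replicate
    by (simp add: shuffle_sum_Cons 0 algebra_simps flip: replicate_append_same)
  finally show ?case using of_nat_neq_0[where 'a = 'k, of i] by (metis mult_eq_0_iff)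
qed

lemma split_first_letter_xy:
  fixes w :: "xy list"
  obtains "w = replicate (length w) a" | i b v where "w = replicate i a @ b # v" "b \<noteq> a"
proof (induction w arbitrary: thesis)
  case (Cons c w)
  show ?case
  proof (cases "c = a")
    case True
    show ?thesis
    proof (rule Cons.IH)
      show thesis if "w = replicate (length w) a" using that True Cons.prems(1) by simp
      show thesis if "w = replicate i a @ b # v" "b \<noteq> a" for i b v
        using that True Cons.prems(2)[of "Suc i" b v] by simp
    qed
  next
    case False
    then show ?thesis using Cons.prems(2)[of 0 c w] by simp
  qed
qed simp

text \<open>
  Every Lyndon word of length at least two starts with \<open>x\<close> and ends with \<open>y\<close>; that the coefficients
  of these words determine a Lie element is proved here with shuffles of single letters only.
\<close>

lemma lie_poly_coeff_eq_0:
  fixes P :: "(xy, 'k::field_char_0) ncfps"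
  assumes P: "P \<in> lie_polys" and "n \<ge> 2"
    and xy: "\<And>u. length u + 2 = n \<Longrightarrow> coeff P (LX # u @ [LY]) = 0"
    and w: "length w = n"
  shows "coeff P w = 0"
proof -
  have 1: "coeff P w = 0" if "length w = n" "hd w = LX" "last w = LY" for w
  proof -
    obtain a u b where w: "w = a # u @ [b]"
    proof (cases w)
      case (Cons a v)
      then show thesis using that \<open>length w = n\<close> \<open>n \<ge> 2\<close> by (cases v rule: rev_cases) auto
    qed (use that \<open>length w = n\<close> \<open>n \<ge> 2\<close> in simp)
    then show ?thesis using xy[of u] that by simp
  qed
  \<comment> \<open>Reversal exchanges words \<open>y...x\<close> and \<open>x...y\<close> up to
    sign.\<close>
  have 2: "coeff P w = 0" if "length w = n" "hd w = LY" "last w = LX" for w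
  proof -
    have "w \<noteq> []" using that \<open>n \<ge> 2\<close> by auto
    then have "coeff P (rev w) = 0" using that by (intro 1) (auto simp: hd_rev last_rev)
    then show ?thesis using lie_poly_rev[OF P, of w] by simp
  qed
  have base: "coeff P w = 0" if "length w = n" "hd w = b" "last w = a" "a \<noteq> b" for w a b
    using that 1[of w] 2[of w] by (cases a; cases b) auto
  have letter: "shuffle_sum (coeff P) [a] w = 0" if "w \<noteq> []" for a w
    using lie_poly_shuffle_sum[OF P] that by simp
  show ?thesis
  proof (cases "w = replicate n (last w)")
    case True
    define a where "a = last w"
    \<comment> \<open>Shuffling \<open>a\<close> into \<open>a^(n-1)\<close> gives \<open>n\<close>
      copies of \<open>a^n\<close>.\<close>
    have "0 = shuffle_sum (coeff P) [a] (replicate (n - 1) a @ [])"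
      using letter[of "replicate (n - 1) a @ []" a] \<open>n \<ge> 2\<close> by simp
    also have "\<dots> = of_nat n * coeff P (replicate n a)"
      unfolding shuffle_sum_replicate using \<open>n \<ge> 2\<close>
      by (cases n) (simp_all add: algebra_simps replicate_append_same)
    finally show ?thesis using True \<open>n \<ge> 2\<close> unfolding a_def by simp
  next
    case False
    \<comment> \<open>The run stripped off consists of the last letter \<open>a\<close> of
      \<open>w\<close>, so that shuffling \<open>a\<close> leads back to words \<open>b...a\<close>
      with \<open>b \<noteq> a\<close>, covered by \<open>base\<close>.\<close>
    then obtain i b v where ibv: "w = replicate i (last w) @ b # v" "b \<noteq> last w"
      using split_first_letter_xy[of w "last w"] w by metis
    have "v \<noteq> []"
      using ibv by (metis last_snoc)
    then have "last v = last w" using ibv by (metis last_ConsR last_appendR list.distinct(1))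
    show ?thesis
      by (subst ibv(1), rule coeff_eq_0_if_shuffle_letter[where n = n])
        (use letter base ibv \<open>v \<noteq> []\<close> \<open>last v = last w\<close> w in \<open>auto dest: arg_cong[where f = length]\<close>)
  qed
qed

lemma hd_shuffle_list:
  "w \<in> set (shuffle_list u v) \<Longrightarrow> u \<noteq> [] \<Longrightarrow> v \<noteq> [] \<Longrightarrow> hd w = hd u \<or> hd w = hd v"
  by (cases u; cases v) auto

lemma shuffle_list_not_Nil: "shuffle_list u v \<noteq> []"
  by (induction u v rule: shuffle_list.induct) auto

text \<open>All shuffles of \<open>xy\<close> and \<open>x\<^sup>n\<^sup>-\<^sup>3y\<close> start with \<open>x\<close> and end with \<open>y\<close>.\<close>

lemma lie_poly_const_coeff_eq_0:
  fixes P :: "(xy, 'k::field_char_0) ncfps"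
  assumes P: "P \<in> lie_polys" and "n \<ge> 4"
    and c: "\<And>u. length u + 2 = n \<Longrightarrow> coeff P (LX # u @ [LY]) = c"
    and w: "length w = n"
  shows "coeff P w = 0"
proof (rule lie_poly_coeff_eq_0[OF P])
  let ?u = "[LX, LY]" and ?v = "replicate (n - 3) LX @ [LY]"
  let ?S = "shuffle_list ?u ?v"
  \<comment> \<open>\<open>n \<ge> 4\<close> makes the exponent \<open>n - 3\<close> positive;
    otherwise the second word would start with \<open>y\<close>.\<close>
  have hd_v: "hd ?v = LX" using \<open>n \<ge> 4\<close> by (cases "n - 3") auto
  have "coeff P s = c" if s: "s \<in> set ?S" for s
  proof -
    have len: "length s = n" using length_shuffle_list[OF s] \<open>n \<ge> 4\<close> by simp
    have "hd s = LX" using hd_shuffle_list[OF s] hd_v by simp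
    then obtain t where t: "s = LX # t" using len \<open>n \<ge> 4\<close> by (cases s) auto
    have "last s = LY" using last_shuffle_list[OF s] by simp
    moreover have "t \<noteq> []" using t len \<open>n \<ge> 4\<close> by auto
    ultimately have "t = butlast t @ [LY]" using t append_butlast_last_id[of t] by simp
    then show ?thesis using c[of "butlast t"] t len \<open>n \<ge> 4\<close> by simp
  qed
  \<comment> \<open>Each shuffle contributes the common value \<open>c\<close>, and there is at
    least one, so characteristic zero forces \<open>c = 0\<close>.\<close>
  then have "shuffle_sum (coeff P) ?u ?v = of_nat (length ?S) * c"
    unfolding shuffle_sum_def by (simp add: sum_list_triv cong: map_cong del: shuffle_list.simps)
  moreover have "shuffle_sum (coeff P) ?u ?v = 0"
    by (rule lie_poly_shuffle_sum[OF P]) simp_all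
  ultimately have "c = 0" using shuffle_list_not_Nil[of ?u ?v] by auto
  then show "coeff P (LX # u @ [LY]) = 0" if "length u + 2 = n" for u using c that by simp
qed (use assms in auto)

section \<open>Closure properties of Lie polynomials and Lie series\<close>

lemma lie_poly_minus: "P \<in> lie_polys \<Longrightarrow> - P \<in> lie_polys"
  using lie_polys.smult[of P "- 1"] by (simp add: smult_minus_one)

lemma lie_poly_diff: "P \<in> lie_polys \<Longrightarrow> Q \<in> lie_polys \<Longrightarrow> P - Q \<in> lie_polys"
  using lie_polys.add[of P "- Q"] by (simp add: lie_poly_minus)

lemma lie_poly_subst_xy:
  assumes "s \<in> lie_polys" "t \<in> lie_polys" "P \<in> lie_polys"
  shows "subst_xy s t P \<in> lie_polys"
  using assms(3)
proof (induction rule: lie_polys.induct)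
  case (var a)
  then show ?case using assms(1,2) by (cases a) (auto simp: subst_xy_var const_term_lie_poly)
next
  case (bracket P Q)
  then show ?case using lie_polys.bracket[OF bracket.IH]
    by (simp add: lie_bracket_def subst_xy_diff subst_xy_mult const_term_lie_poly assms)
qed (auto simp: subst_xy_add subst_xy_smult intro: lie_polys.intros)

lemma hom_part_add: "hom_part n (P + Q) = hom_part n P + hom_part n Q"
  and hom_part_diff: "hom_part n (P - Q) = hom_part n P - hom_part n Q"
  for P Q :: "('a, 'k::ring_1) ncfps"
  by (rule ncfps_eqI; simp)+

lemma lie_series_subst_xy:
  assumes "linear_form s" "linear_form t" "s \<in> lie_polys" "t \<in> lie_polys" "P \<in> lie_series"
  shows "subst_xy s t P \<in> lie_series"
  using assms by (auto simp: lie_series_def hom_part_subst_xy lie_poly_subst_xy)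

lemma lie_series_add: "P \<in> lie_series \<Longrightarrow> Q \<in> lie_series \<Longrightarrow> P + Q \<in> lie_series"
  by (auto simp: lie_series_def hom_part_add intro: lie_polys.add)

lemma lie_series_bracket:
  assumes "linear_form s" "s \<in> lie_polys" "P \<in> lie_series"
  shows "lie_bracket P s \<in> lie_series"
  unfolding lie_series_def
proof (intro CollectI allI)
  fix n
  show "hom_part n (lie_bracket P s) \<in> lie_polys"
  proof (cases n)
    case 0
    \<comment> \<open>\<open>smult 0 s\<close> exhibits zero as a Lie polynomial.\<close>
    have "hom_part 0 (lie_bracket P s) = smult 0 s"
      by (rule ncfps_eqI) (simp add: lie_bracket_def)
    then show ?thesis using 0 assms by (simp add: lie_polys.smult)
  next
    case (Suc m)
    have "hom_part (Suc m) (lie_bracket P s) = lie_bracket (hom_part m P) s"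
      using assms(1) by (simp add: lie_bracket_def hom_part_diff hom_part_linear_form_mult)
    then show ?thesis using Suc assms by (auto simp: lie_series_def intro: lie_polys.bracket)
  qed
qed

lemma lie_series_rev:
  assumes "P \<in> lie_series"
  shows "coeff P (rev w) = (- 1) ^ (length w + 1) * coeff P w"
proof -
  have "hom_part (length w) P \<in> lie_polys" using assms by (simp add: lie_series_def)
  from lie_poly_rev[OF this, of w] show ?thesis by simp
qed

section \<open>The antipode of the harmonic coproduct\<close>

definition xy_word :: "nat list \<Rightarrow> (xy, 'k::comm_ring_1) ncfps" where
  "xy_word u = word_eval x_ser y_ser (yword_to_xy u)"

text \<open>
  The antipode sends the group-like series \<open>1 - \<Sum> Y\<^sub>m t\<^sup>m = (1 - t x)\<^sup>-\<^sup>1 (1 - t (x + y))\<close> to its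
  inverse \<open>(1 - t (x + y))\<^sup>-\<^sup>1 (1 - t x) = 1 + \<Sum> (x + y)\<^sup>m\<^sup>-\<^sup>1 y t\<^sup>m\<close>.
\<close>

definition antipode_gen :: "nat \<Rightarrow> (xy, 'k::comm_ring_1) ncfps" where
  "antipode_gen k = - ((x_ser + y_ser) ^ k * y_ser)"

text \<open>The factors appear in reverse order because the antipode is antimultiplicative.\<close>

fun antipode_word :: "nat list \<Rightarrow> (xy, 'k::comm_ring_1) ncfps" where
  "antipode_word [] = 1"
| "antipode_word (k # u) = antipode_word u * antipode_gen k"

lemma word_eval_replicate:
  "word_eval s t (replicate k LX) = s ^ k" "word_eval s t (replicate k LY) = t ^ k"
  by (induction k) (simp_all add: word_eval_Cons)

lemma xy_word_Nil [simp]: "xy_word [] = 1"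
  and xy_word_Cons: "xy_word (k # u) = x_ser ^ k * y_ser * xy_word u"
  by (simp_all add: xy_word_def yword_to_xy_def word_eval_append word_eval_Cons
      word_eval_replicate mult.assoc)

text \<open>The sum telescopes: its terms are
  \<open>a^(i+1) b^(k-1-i) - a^i b^(k-i)\<close>.\<close>

lemma power_diff_noncomm:
  fixes a b :: "'r::ring_1"
  shows "(\<Sum>i<k. a ^ i * (a - b) * b ^ (k - 1 - i)) = a ^ k - b ^ k"
proof (induction k)
  case (Suc k)
  have "(\<Sum>i<k. a ^ i * (a - b) * b ^ (k - i)) = (\<Sum>i<k. a ^ i * (a - b) * b ^ (k - 1 - i) * b)"
    by (rule sum.cong) (simp_all add: mult.assoc flip: power_Suc2 Suc_diff_Suc)
  also have "\<dots> = (a ^ k - b ^ k) * b"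
    by (simp only: Suc flip: sum_distrib_right)
  finally show ?case by (simp add: algebra_simps power_commutes power_Suc2 del: power_Suc)
qed simp

text \<open>The antipode axiom at the generator \<open>Y_(k+1)\<close>: writing
  \<open>y = (x + y) - x\<close> makes the sum telescope. The indices \<open>i\<close> and
  \<open>k - 1 - i\<close> stand for \<open>Y_(i+1)\<close> and \<open>Y_(k-i)\<close>.\<close>

lemma antipode_gen_convolution:
  "antipode_gen k + x_ser ^ k * y_ser
    - (\<Sum>i<k. antipode_gen i * (x_ser ^ (k - 1 - i) * y_ser)) = 0"
proof -
  have "(\<Sum>i<k. antipode_gen i * (x_ser ^ (k - 1 - i) * y_ser))
      = - (\<Sum>i<k. (x_ser + y_ser) ^ i * ((x_ser + y_ser) - x_ser) * x_ser ^ (k - 1 - i)) * y_ser"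
    by (simp add: antipode_gen_def sum_distrib_right sum_negf mult.assoc)
  also have "\<dots> = - ((x_ser + y_ser) ^ k - x_ser ^ k) * y_ser"
    by (simp only: power_diff_noncomm)
  finally have sum: "(\<Sum>i<k. antipode_gen i * (x_ser ^ (k - 1 - i) * y_ser)) = \<dots>" .
  show ?thesis by (subst sum) (simp add: antipode_gen_def algebra_simps)
qed

section \<open>Convolution of the antipode with the identity\<close>

definition weight_pairs :: "nat \<Rightarrow> (nat list \<times> nat list) set" where
  "weight_pairs n = {(u, v). yweight u + yweight v = n}"

text \<open>The map \<open>u \<otimes> v \<mapsto> S(u) c v\<close> in degree \<open>n\<close>, where \<open>S\<close> is the antipode of \<open>\<Delta>\<^sub>*\<close>.\<close>

definition convolve :: "nat \<Rightarrow> (xy, 'k::comm_ring_1) ncfps \<Rightarrow> 'k ytensor \<Rightarrow> (xy, 'k) ncfps" where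
  "convolve n c T = (\<Sum>(u, v)\<in>weight_pairs n.
    smult (coeff (coeff T u) v) (antipode_word u * c * xy_word v))"

lemma finite_weight_pairs: "finite (weight_pairs n)"
proof (rule finite_subset)
  show "weight_pairs n \<subseteq> (\<Union>i\<le>n. {u. yweight u = i}) \<times> (\<Union>i\<le>n. {v. yweight v = i})"
    by (auto simp: weight_pairs_def)
qed (auto simp: finite_yweight)

lemma yweight_simps [simp]: "yweight [] = 0" "yweight (k # u) = Suc k + yweight u"
  by (simp_all add: yweight_def)

lemma convolve_add: "convolve n c (T + U) = convolve n c T + convolve n c U"
  and convolve_diff: "convolve n c (T - U) = convolve n c T - convolve n c U"
  and convolve_add_middle: "convolve n (c + d) T = convolve n c T + convolve n d T"
  and convolve_diff_middle: "convolve n (c - d) T = convolve n c T - convolve n d T"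
  and convolve_zero_middle: "convolve n 0 T = 0"
  by (rule ncfps_eqI;
      simp add: convolve_def coeff_sum case_prod_unfold algebra_simps sum.distrib sum_subtractf)+

lemma convolve_sum: "convolve n c (\<Sum>i\<in>I. T i) = (\<Sum>i\<in>I. convolve n c (T i))"
proof -
  have "convolve n c 0 = 0" by (rule ncfps_eqI) (simp add: convolve_def coeff_sum case_prod_unfold)
  then show ?thesis
    by (induction I rule: infinite_finite_induct) (simp_all add: convolve_add)
qed

lemma convolve_sum_middle: "convolve n (\<Sum>i\<in>I. c i) T = (\<Sum>i\<in>I. convolve n (c i) T)"
  by (induction I rule: infinite_finite_induct)
    (simp_all add: convolve_zero_middle convolve_add_middle)

lemma tensor_var_1: "tensor (var a) 1 = var a"
  by (intro ncfps_eqI) auto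

text \<open>\<open>tensor 1 Q\<close> is the constant series with coefficient \<open>Q\<close>, so
  it acts coefficientwise.\<close>

lemma coeff_tensor_1_mult: "coeff (tensor 1 Q * T) u = Q * coeff T u"
proof -
  have "coeff (tensor 1 Q * T) u = (\<Sum>i\<le>length u. if i = 0 then Q * coeff T u else 0)"
    unfolding coeff_mult
  proof (rule sum.cong)
    fix i assume "i \<in> {..length u}"
    moreover have "smult 0 Q = 0" by (rule ncfps_eqI) simp
    ultimately show "coeff (tensor 1 Q) (take i u) * coeff T (drop i u)
        = (if i = 0 then Q * coeff T u else 0)"
      by (auto simp: tensor_def)
  qed simp
  then show ?thesis by simp
qed

text \<open>Only words \<open>u\<close> starting with \<open>a\<close> contribute, and
  antimultiplicativity places the antipode of \<open>a\<close> next to \<open>c\<close>. This is why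
  \<open>convolve\<close> carries a middle factor.\<close>

lemma convolve_left_gen:
  "convolve (n + Suc a) c (tensor (var a) 1 * T) = convolve n (antipode_gen a * c) T"
proof -
  let ?f = "\<lambda>(u, v). smult (coeff (coeff (var a * T) u) v) (antipode_word u * c * xy_word v)"
  have "convolve (n + Suc a) c (tensor (var a) 1 * T) = sum ?f (weight_pairs (n + Suc a))"
    by (simp add: convolve_def tensor_var_1)
  also have "\<dots> = sum ?f ((\<lambda>(u, v). (a # u, v)) ` weight_pairs n)"
  proof (rule sum.mono_neutral_right)
    show "\<forall>p\<in>weight_pairs (n + Suc a) - (\<lambda>(u, v). (a # u, v)) ` weight_pairs n. ?f p = 0"
    proof clarify
      fix u v assume uv: "(u, v) \<in> weight_pairs (n + Suc a)"
        "(u, v) \<notin> (\<lambda>(u, v). (a # u, v)) ` weight_pairs n"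
      have "coeff (var a * T) u = 0"
      proof (cases u)
        case (Cons b u')
        then have "a \<noteq> b" using uv by (force simp: weight_pairs_def)
        then show ?thesis using Cons by simp
      qed simp
      then show "smult (coeff (coeff (var a * T) u) v) (antipode_word u * c * xy_word v) = 0"
        by (intro ncfps_eqI) simp
    qed
  qed (use finite_weight_pairs in \<open>auto simp: weight_pairs_def\<close>)
  also have "\<dots> = convolve n (antipode_gen a * c) T"
    by (subst sum.reindex) (auto simp: inj_on_def convolve_def mult.assoc intro!: sum.cong)
  finally show ?thesis .
qed

lemma convolve_right_gen:
  "convolve (n + Suc b) c (tensor 1 (var b) * T) = convolve n (c * (x_ser ^ b * y_ser)) T"
proof -
  let ?f = "\<lambda>(u, v). smult (coeff (var b * coeff T u) v) (antipode_word u * c * xy_word v)"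
  have "convolve (n + Suc b) c (tensor 1 (var b) * T) = sum ?f (weight_pairs (n + Suc b))"
    by (simp add: convolve_def coeff_tensor_1_mult)
  also have "\<dots> = sum ?f ((\<lambda>(u, v). (u, b # v)) ` weight_pairs n)"
  proof (rule sum.mono_neutral_right)
    show "\<forall>p\<in>weight_pairs (n + Suc b) - (\<lambda>(u, v). (u, b # v)) ` weight_pairs n. ?f p = 0"
    proof clarify
      fix u v assume uv: "(u, v) \<in> weight_pairs (n + Suc b)"
        "(u, v) \<notin> (\<lambda>(u, v). (u, b # v)) ` weight_pairs n"
      have "coeff (var b * coeff T u) v = 0"
      proof (cases v)
        case (Cons a v')
        then have "a \<noteq> b" using uv by (force simp: weight_pairs_def)
        then show ?thesis using Cons by simp
      qed simp
      then show "smult (coeff (var b * coeff T u) v) (antipode_word u * c * xy_word v) = 0"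
        by (intro ncfps_eqI) simp
    qed
  qed (use finite_weight_pairs in \<open>auto simp: weight_pairs_def\<close>)
  also have "\<dots> = convolve n (c * (x_ser ^ b * y_ser)) T"
    by (subst sum.reindex)
      (auto simp: inj_on_def convolve_def xy_word_Cons mult.assoc intro!: sum.cong)
  finally show ?thesis .
qed

text \<open>All terms of the coproduct of the generator move into the middle factor, where they add
  up to zero by \<open>antipode_gen_convolution\<close>, whatever \<open>T\<close> is.\<close>

lemma convolve_coprod_gen: "convolve (n + Suc k) 1 (coprod_gen (Suc k) * T) = 0"
proof -
  have both: "convolve (n + Suc k) 1 (tensor (Y_ser (Suc i)) (Y_ser (k - i)) * T)
      = convolve n (antipode_gen i * (x_ser ^ (k - 1 - i) * y_ser)) T" if "i < k" for i
  proof -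
    have "tensor (Y_ser (Suc i)) (Y_ser (k - i)) * T
        = tensor (var i) 1 * (tensor 1 (var (k - 1 - i)) * T)"
      by (simp add: Y_ser_def tensor_mult flip: mult.assoc)
    moreover have "n + Suc k = n + Suc (k - 1 - i) + Suc i" using that by simp
    ultimately show ?thesis
      by (simp only: convolve_left_gen convolve_right_gen) simp
  qed
  have "coprod_gen (Suc k) * T = tensor (var k) 1 * T + tensor 1 (var k) * T
      - (\<Sum>i<k. tensor (Y_ser (Suc i)) (Y_ser (k - i)) * T)"
    unfolding coprod_gen_def One_nat_def sum.shift_bounds_Suc_ivl lessThan_atLeast0
    by (simp only: distrib_right left_diff_distrib sum_distrib_right) (simp add: Y_ser_def)
  then have "convolve (n + Suc k) 1 (coprod_gen (Suc k) * T)
      = convolve n (antipode_gen k) T + convolve n (x_ser ^ k * y_ser) T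
        - (\<Sum>i<k. convolve n (antipode_gen i * (x_ser ^ (k - 1 - i) * y_ser)) T)"
    by (simp only: convolve_add convolve_diff convolve_sum convolve_left_gen convolve_right_gen
        mult_1_left mult_1_right) (simp add: both del: diff_Suc_Suc add_Suc_right)
  also have "\<dots> = convolve n (antipode_gen k + x_ser ^ k * y_ser
      - (\<Sum>i<k. antipode_gen i * (x_ser ^ (k - 1 - i) * y_ser))) T"
    by (simp only: convolve_add_middle convolve_diff_middle convolve_sum_middle)
  finally show ?thesis by (simp only: antipode_gen_convolution convolve_zero_middle)
qed

text \<open>The antipode axiom in positive degree. A word of weight \<open>n > 0\<close> has a first
  generator, so \<open>convolve_coprod_gen\<close> applies to it; series follow by linearity, as
  only the finitely many words of weight \<open>n\<close> enter.\<close>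

lemma convolve_coprod:
  fixes P :: "'k::comm_ring_1 yseries"
  assumes "n > 0"
  shows "convolve n 1 (coprod P) = 0"
proof -
  have word: "convolve n 1 (coprod_word w :: 'k ytensor) = 0" if "yweight w = n" for w
  proof (cases w)
    case (Cons k v)
    then have "n = yweight v + Suc k" using that by simp
    then show ?thesis using Cons
      by (simp only: coprod_word_def list.map prod_list.Cons convolve_coprod_gen)
  qed (use that assms in simp)
  let ?e = "\<lambda>u v. antipode_word u * 1 * xy_word v :: (xy, 'k) ncfps"
  have "convolve n 1 (coprod P)
      = (\<Sum>w | yweight w = n. smult (coeff P w) (convolve n 1 (coprod_word w)))"
  proof (rule ncfps_eqI)
    fix q
    have "coeff (convolve n 1 (coprod P)) q = (\<Sum>(u, v)\<in>weight_pairs n. \<Sum>w | yweight w = n.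
        coeff P w * coeff (coeff (coprod_word w) u) v * coeff (?e u v) q)"
      unfolding convolve_def coeff_sum
      by (rule sum.cong) (auto simp: coprod_def weight_pairs_def sum_distrib_right)
    also have "\<dots> = (\<Sum>w | yweight w = n. \<Sum>(u, v)\<in>weight_pairs n.
        coeff P w * coeff (coeff (coprod_word w) u) v * coeff (?e u v) q)"
      unfolding case_prod_unfold by (rule sum.swap)
    also have "\<dots> = coeff (\<Sum>w | yweight w = n.
        smult (coeff P w) (convolve n 1 (coprod_word w))) q"
      by (simp add: convolve_def coeff_sum case_prod_unfold sum_distrib_left mult.assoc)
    finally show "coeff (convolve n 1 (coprod P)) q = \<dots>" .
  qed
  also have "\<dots> = 0"
    by (rule sum.neutral) (auto simp: word intro!: ncfps_eqI)
  finally show ?thesis .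
qed

lemma convolve_tensor_1:
  assumes "n > 0"
  shows "convolve n 1 (tensor P 1) = (\<Sum>u | yweight u = n. smult (coeff P u) (antipode_word u))"
    and "convolve n 1 (tensor 1 P) = (\<Sum>v | yweight v = n. smult (coeff P v) (xy_word v))"
proof -
  have 0: "smult 0 Q = 0" for Q :: "(xy, 'a) ncfps" by (rule ncfps_eqI) simp
  have "convolve n 1 (tensor P 1) = (\<Sum>(u, v)\<in>(\<lambda>u. (u, [])) ` {u. yweight u = n}.
      smult (coeff P u * coeff 1 v) (antipode_word u * 1 * xy_word v))"
    unfolding convolve_def
    by (rule sum.mono_neutral_cong_right)
      (use finite_weight_pairs in \<open>auto simp: weight_pairs_def 0 image_iff\<close>)
  also have "\<dots> = (\<Sum>u | yweight u = n. smult (coeff P u) (antipode_word u))"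
    by (subst sum.reindex) (auto simp: inj_on_def)
  finally show "convolve n 1 (tensor P 1)
    = (\<Sum>u | yweight u = n. smult (coeff P u) (antipode_word u))" .
  have "convolve n 1 (tensor 1 P) = (\<Sum>(u, v)\<in>(\<lambda>v. ([], v)) ` {v. yweight v = n}.
      smult (coeff 1 u * coeff P v) (antipode_word u * 1 * xy_word v))"
    unfolding convolve_def
    by (rule sum.mono_neutral_cong_right)
      (use finite_weight_pairs in \<open>auto simp: weight_pairs_def 0 image_iff\<close>)
  also have "\<dots> = (\<Sum>v | yweight v = n. smult (coeff P v) (xy_word v))"
    by (subst sum.reindex) (auto simp: inj_on_def)
  finally show "convolve n 1 (tensor 1 P)
    = (\<Sum>v | yweight v = n. smult (coeff P v) (xy_word v))" .
qed

text \<open>For primitive \<open>P\<close> the convolution is the antipode of \<open>P\<close> plus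
  \<open>P\<close> itself, so the antipode negates \<open>P\<close> in each positive degree.\<close>

lemma antipode_primitive:
  assumes "coprod P = tensor P 1 + tensor 1 P" "n > 0"
  shows "(\<Sum>u | yweight u = n. smult (coeff P u) (antipode_word u + xy_word u)) = 0"
proof -
  have "convolve n 1 (tensor P 1 + tensor 1 P) = 0"
    using convolve_coprod[OF assms(2), of P] assms(1) by simp
  then show ?thesis
    by (simp add: convolve_add convolve_tensor_1[OF assms(2)] smult_add_right sum.distrib)
qed

section \<open>The double shuffle Lie algebra\<close>

text \<open>The first argument counts the letters \<open>x\<close> read since the last
  \<open>y\<close>. A trailing run of \<open>x\<close> is dropped, so \<open>xy_to_yword 0\<close>
  is inverse to \<open>yword_to_xy\<close> only on the empty word and words ending in
  \<open>y\<close>.\<close>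

fun xy_to_yword :: "nat \<Rightarrow> xy list \<Rightarrow> nat list" where
  "xy_to_yword k [] = []"
| "xy_to_yword k (LX # w) = xy_to_yword (Suc k) w"
| "xy_to_yword k (LY # w) = k # xy_to_yword 0 w"

lemma yword_to_xy_simps [simp]:
  "yword_to_xy [] = []"
  "yword_to_xy (k # u) = replicate k LX @ LY # yword_to_xy u"
  by (simp_all add: yword_to_xy_def)

lemma length_yword_to_xy: "length (yword_to_xy u) = yweight u"
  by (induction u) auto

lemma xy_to_yword_to_xy: "xy_to_yword 0 (yword_to_xy u) = u"
proof (induction u)
  case (Cons k u)
  have "xy_to_yword j (replicate k LX @ w) = xy_to_yword (j + k) w" for j w
    by (induction k arbitrary: j) auto
  with Cons show ?case by simp
qed simp

lemma yword_to_xy_to_yword: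
  "w = [] \<or> last w = LY \<Longrightarrow> w \<noteq> [] \<or> k = 0 \<Longrightarrow> yword_to_xy (xy_to_yword k w) = replicate k LX @ w"
  by (induction k w rule: xy_to_yword.induct)
    (auto simp: replicate_append_same split: if_splits)

lemma yword_to_xy_snoc:
  assumes "u \<noteq> []"
  shows "\<exists>q. yword_to_xy u = q @ [LY]"
  using assms by (induction u rule: rev_induct) (auto simp: yword_to_xy_def)

lemma bij_betw_yword_to_xy:
  "bij_betw yword_to_xy {u. yweight u = Suc n} ((\<lambda>q. q @ [LY]) ` {q. length q = n})"
proof (rule bij_betw_byWitness[where f' = "xy_to_yword 0"])
  show "yword_to_xy ` {u. yweight u = Suc n} \<subseteq> (\<lambda>q. q @ [LY]) ` {q. length q = n}"
  proof clarify
    fix u assume u: "yweight u = Suc n"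
    then obtain q where "yword_to_xy u = q @ [LY]" using yword_to_xy_snoc[of u] by fastforce
    then show "yword_to_xy u \<in> (\<lambda>q. q @ [LY]) ` {q. length q = n}"
      using length_yword_to_xy[of u] u by auto
  qed
  have "yweight (xy_to_yword 0 (q @ [LY])) = Suc (length q)" for q
    by (simp add: yword_to_xy_to_yword flip: length_yword_to_xy)
  then show "xy_to_yword 0 ` (\<lambda>q. q @ [LY]) ` {q. length q = n} \<subseteq> {u. yweight u = Suc n}"
    by auto
qed (auto simp: xy_to_yword_to_xy yword_to_xy_to_yword)

section \<open>The antipode in the letters \<open>z\<close> and \<open>y\<close>\<close>

abbreviation z_ser :: "(xy, 'k::ring_1) ncfps" where "z_ser \<equiv> - x_ser - y_ser"

lemma antipode_gen_conv: "antipode_gen k = smult ((- 1) ^ Suc k) (z_ser ^ k * y_ser)"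
proof -
  have "(x_ser + y_ser :: (xy, 'a) ncfps) = smult (- 1) z_ser"
    by (simp add: smult_minus_one)
  moreover have "smult (- 1) z_ser ^ k = smult ((- 1) ^ k) (z_ser ^ k :: (xy, 'a) ncfps)"
    by (induction k) (simp_all add: smult_mult_left smult_mult_right smult_smult)
  ultimately show ?thesis
    by (simp add: antipode_gen_def smult_mult_left smult_smult flip: smult_minus_one)
qed

text \<open>The antipode of \<open>u\<close> consists of blocks \<open>z^k y\<close> in reverse
  order, whereas the reversed word consists of blocks \<open>y z^k\<close>. An additional
  \<open>y\<close> on the left of the former and on the right of the latter makes them
  agree.\<close>

lemma y_mult_antipode_word:
  "(y_ser :: (xy, 'k::comm_ring_1) ncfps) * antipode_word u
    = smult ((- 1) ^ yweight u) (word_eval z_ser y_ser (rev (yword_to_xy u)) * y_ser)"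
proof (induction u)
  case (Cons k u)
  have "(y_ser :: (xy, 'k) ncfps) * antipode_word (k # u) = y_ser * antipode_word u * antipode_gen k"
    by (simp add: mult.assoc)
  also have "\<dots> = smult ((- 1) ^ yweight u * (- 1) ^ Suc k)
      (word_eval z_ser y_ser (rev (yword_to_xy u)) * y_ser * (z_ser ^ k * y_ser))"
    unfolding Cons antipode_gen_conv by (simp only: smult_mult_left smult_mult_right smult_smult mult_ac)
  finally show ?case
    by (simp add: word_eval_append word_eval_Cons word_eval_replicate power_add mult.assoc
        mult.commute[of "(- 1) ^ yweight u :: 'k"])
qed simp

lemma antipode_word_conv:
  assumes "yword_to_xy u = q @ [LY]"
  shows "antipode_word u = smult ((- 1) ^ Suc (length q)) (word_eval z_ser y_ser (rev q) * y_ser)"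
proof (rule var_mult_left_cancel)
  have "yweight u = Suc (length q)" using assms by (simp flip: length_yword_to_xy)
  then show "y_ser * antipode_word u
      = y_ser * smult ((- 1) ^ Suc (length q)) (word_eval z_ser y_ser (rev q) * y_ser)"
    unfolding y_mult_antipode_word assms
    by (simp add: word_eval_Cons smult_mult_right mult.assoc)
qed

lemma coeff_reg_snoc:
  assumes "yword_to_xy u = q @ [LY]"
  shows "coeff (reg \<psi>) u = coeff \<psi> (q @ [LY]) + (if q = replicate (length q) LY
    then coeff \<psi> (replicate (length q) LX @ [LY]) / of_nat (Suc (length q)) else 0)"
  using assms
  by (auto simp: reg_def to_yseries_def \<pi>\<^sub>Y_def corr_series_def replicate_append_same [symmetric])

lemma subst_xy_sum:
  "subst_xy s t (\<Sum>i\<in>I. P i) = (\<Sum>i\<in>I. subst_xy s t (P i))"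
proof -
  have "subst_xy s t 0 = 0" using subst_xy_diff[of s t 0 0] by simp
  then show ?thesis by (induction I rule: infinite_finite_induct) (simp_all add: subst_xy_add)
qed

text \<open>Up to a multiple of \<open>y\<^sup>n\<close>, this is \<open>\<psi>\<^sub>y(x, y) = S(\<psi>\<^sub>y)(z, y)\<close> in degree \<open>n\<close>, with \<open>S\<close> the antipode of the
  shuffle Hopf algebra.\<close>

lemma dmr\<^sub>0_right_part_y:
  fixes \<psi> :: "(xy, 'k::field_char_0) ncfps"
  assumes "\<psi> \<in> dmr\<^sub>0"
  obtains c where "(\<Sum>q | length q = n. smult (coeff \<psi> (q @ [LY]))
    (word_eval x_ser y_ser q - smult ((- 1) ^ n) (word_eval z_ser y_ser (rev q)))) = smult c (y_ser ^ n)"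
proof -
  \<comment> \<open>The coefficient of \<open>y^(n+1)\<close> in
    \<open>corr_series \<psi>\<close>.\<close>
  define d where "d = coeff \<psi> (replicate n LX @ [LY]) / of_nat (Suc n)"
  define D :: "xy list \<Rightarrow> (xy, 'k) ncfps" where
    "D q = word_eval x_ser y_ser q - smult ((- 1) ^ n) (word_eval z_ser y_ser (rev q))" for q
  let ?Q = "{q :: xy list. length q = n}"
  have fin: "finite ?Q" by (rule finite_subset[OF _ finite_xy_words[of n]]) auto
  have "0 = (\<Sum>u | yweight u = Suc n. smult (coeff (reg \<psi>) u) (antipode_word u + xy_word u))"
    using antipode_primitive[of "reg \<psi>" "Suc n"] assms by (simp add: dmr\<^sub>0_def)
  \<comment> \<open>Words of weight \<open>n + 1\<close> in the \<open>Y_m\<close> become words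
    \<open>q y\<close> with \<open>q\<close> of length \<open>n\<close>; \<open>butlast\<close>
    recovers \<open>q\<close>.\<close>
  also have "\<dots> = (\<Sum>w\<in>(\<lambda>q. q @ [LY]) ` ?Q. smult (coeff \<psi> w
      + (if w = replicate (Suc n) LY then d else 0)) (D (butlast w) * y_ser))"
    (is "_ = sum ?F _")
  proof -
    have "smult (coeff (reg \<psi>) u) (antipode_word u + xy_word u) = ?F (yword_to_xy u)"
      if u: "yweight u = Suc n" for u
    proof -
      obtain q where q: "yword_to_xy u = q @ [LY]" using yword_to_xy_snoc[of u] u by fastforce
      then have n: "length q = n" using length_yword_to_xy[of u] u by simp
      have "antipode_word u + xy_word u = D q * y_ser"
      proof -
        have "antipode_word u = smult (- ((- 1) ^ n) :: 'k) (word_eval z_ser y_ser (rev q) * y_ser)"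
          using antipode_word_conv[OF q] by (simp add: n)
        moreover have "xy_word u = word_eval x_ser y_ser q * (y_ser :: (xy, 'k) ncfps)"
          by (simp add: xy_word_def q word_eval_append word_eval_Cons)
        moreover have "D q * y_ser = word_eval x_ser y_ser q * y_ser
            - smult ((- 1) ^ n) (word_eval z_ser y_ser (rev q) * y_ser)"
          unfolding D_def by (simp only: left_diff_distrib smult_mult_left)
        ultimately show ?thesis
          by (intro ncfps_eqI) (simp only: coeff_simps coeff_smult, simp)
      qed
      moreover have "coeff (reg \<psi>) u = coeff \<psi> (q @ [LY])
          + (if q @ [LY] = replicate (Suc n) LY then d else 0)"
        unfolding coeff_reg_snoc[OF q] n d_def by (simp flip: replicate_append_same)
      ultimately show ?thesis by (simp add: q)
    qed
    then have "(\<Sum>u | yweight u = Suc n. smult (coeff (reg \<psi>) u) (antipode_word u + xy_word u))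
        = (\<Sum>u | yweight u = Suc n. ?F (yword_to_xy u))"
      by (intro sum.cong) auto
    also have "\<dots> = sum ?F ((\<lambda>q. q @ [LY]) ` ?Q)"
      by (rule sum.reindex_bij_betw[OF bij_betw_yword_to_xy])
    finally show ?thesis .
  qed
  also have "\<dots> = (\<Sum>q\<in>?Q. smult (coeff \<psi> (q @ [LY])
      + (if q = replicate n LY then d else 0)) (D q * y_ser))"
    by (subst sum.reindex) (auto simp: inj_on_def replicate_append_same [symmetric])
  also have "\<dots> = (\<Sum>q\<in>?Q. smult (coeff \<psi> (q @ [LY])
      + (if q = replicate n LY then d else 0)) (D q)) * y_ser"
    by (simp add: sum_distrib_right smult_mult_left)
  finally have "(\<Sum>q\<in>?Q. smult (coeff \<psi> (q @ [LY])
      + (if q = replicate n LY then d else 0)) (D q)) = 0"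
    using mult_var_right_cancel[of _ LY 0] by simp
  \<comment> \<open>The correction \<open>d\<close> enters only at \<open>q = y^n\<close>, where
    \<open>D q\<close> is itself a multiple of \<open>y^n\<close>; this produces the right-hand
    side.\<close>
  moreover have "smult (a + (if q = replicate n LY then d else 0)) (D q)
      = smult a (D q) + (if q = replicate n LY then smult d (D (replicate n LY)) else 0)" for a q
    by (rule ncfps_eqI) (simp add: distrib_right)
  ultimately have "(\<Sum>q\<in>?Q. smult (coeff \<psi> (q @ [LY])) (D q)) + smult d (D (replicate n LY)) = 0"
    using fin by (simp add: sum.distrib)
  then have "(\<Sum>q\<in>?Q. smult (coeff \<psi> (q @ [LY])) (D q)) = smult (- d) (D (replicate n LY))"
    by (simp add: add_eq_0_iff2 smult_smult flip: smult_minus_one)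
  also have "D (replicate n LY) = smult (1 - (- 1) ^ n) (y_ser ^ n)"
    unfolding D_def rev_replicate word_eval_replicate
    by (rule ncfps_eqI) (simp add: algebra_simps)
  finally show thesis by (intro that[of "- d * (1 - (- 1) ^ n)"]) (simp add: D_def smult_smult)
qed

section \<open>Equal coefficients at words \<open>x...y\<close> and the bracket identity\<close>

lemma linear_form_xyz: "linear_form x_ser" "linear_form y_ser" "linear_form z_ser"
  by (simp_all add: linear_form_var linear_form_minus linear_form_diff)

lemma lie_poly_z: "z_ser \<in> lie_polys"
  by (simp add: lie_poly_minus lie_poly_diff lie_polys.var)

text \<open>Reversal is an antiautomorphism fixing linear forms, so it only reverses the order of
  the factors.\<close>

lemma coeff_word_eval_rev:
  fixes s t :: "('a, 'k::comm_ring_1) ncfps"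
  assumes "linear_form s" "linear_form t"
  shows "coeff (word_eval s t q) (rev w) = coeff (word_eval s t (rev q)) w"
proof (induction q arbitrary: w)
  case (Cons a q)
  have lin: "linear_form (case_xy s t a)" using assms by (cases a) auto
  have "coeff (case_xy s t a) (rev v) = coeff (case_xy s t a) v" for v
  proof (cases "length v = 1")
    case True
    then show ?thesis by (cases v) auto
  qed (use lin in \<open>simp add: linear_form_def\<close>)
  then show ?case
    by (simp add: word_eval_Cons word_eval_append coeff_mult_rev coeff_mult[of "word_eval s t _"]
        Cons)
qed simp

lemma coeff_subst_xy_linear:
  assumes "linear_form s" "linear_form t"
  shows "coeff (subst_xy s t P) w
    = (\<Sum>q | length q = length w. coeff P q * coeff (word_eval s t q) w)"
  unfolding coeff_subst_xy
  by (rule sum.mono_neutral_right)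
    (auto simp: finite_xy_words coeff_word_eval_linear_form[OF assms])

text \<open>\<open>z^n = (-1)^n (x + y)^n\<close> contains all words of length \<open>n\<close>
  equally. Hence a multiple of \<open>y^n\<close> contributes a constant once \<open>y\<close> is
  replaced by \<open>z\<close>.\<close>

lemma coeff_z_power: "length u = n \<Longrightarrow> coeff (z_ser ^ n) u = (- 1) ^ n"
proof (induction n arbitrary: u)
  case (Suc n)
  then obtain a v where u: "u = a # v" "length v = n" by (cases u) auto
  have "z_ser * P = - (x_ser * P) - y_ser * P" for P :: "(xy, 'a) ncfps"
    by (simp add: algebra_simps)
  with Suc u show ?case by (cases a) simp_all
qed simp

text \<open>Substituting into \<open>P = \<epsilon>(P) + P_x x + P_y y\<close> and expanding the
  final \<open>z = - x - y\<close> isolates \<open>P_y\<close>: if \<open>s\<close> is a letter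
  other than \<open>a\<close>, the first term on the right vanishes.\<close>

lemma coeff_subst_xy_snoc:
  assumes "const_term s = 0"
  shows "coeff (subst_xy s z_ser P) (w @ [a])
    = coeff (subst_xy s z_ser (right_part LX P) * s) (w @ [a])
      - coeff (subst_xy s z_ser (right_part LY P)) w"
proof -
  note c = assms const_term_linear_form[OF linear_form_xyz(3)]
  have z: "Q * z_ser = - (Q * x_ser) - Q * y_ser" for Q :: "(xy, 'a) ncfps"
    by (simp add: algebra_simps)
  have "subst_xy s z_ser P = smult (const_term P) 1
      + subst_xy s z_ser (right_part LX P) * s + subst_xy s z_ser (right_part LY P) * z_ser"
    by (subst right_decomposition[of P])
      (simp only: subst_xy_add subst_xy_smult subst_xy_mult[OF c] subst_xy_1[OF c]
        subst_xy_var[OF c] xy.case)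
  then show ?thesis by (cases a) (simp_all add: z)
qed

text \<open>The image of the left-hand side of the theorem under \<open>x \<mapsto> x\<close>, \<open>y \<mapsto> z\<close>.\<close>

lemma dmr\<^sub>0_bracket_identity:
  fixes \<psi> :: "(xy, 'k::field_char_0) ncfps"
  assumes "\<psi> \<in> dmr\<^sub>0"
  shows "lie_bracket (subst_xy x_ser z_ser \<psi>) x_ser + lie_bracket (subst_xy y_ser z_ser \<psi>) y_ser = 0"
    (is "?E = 0")
proof (rule ncfps_eqI)
  fix w :: "xy list"
  let ?p = "subst_xy x_ser z_ser \<psi>" and ?q = "subst_xy y_ser z_ser \<psi>"
  have lie: "\<psi> \<in> lie_series" and small: "\<And>w. length w < 3 \<Longrightarrow> coeff \<psi> w = 0"
    using assms by (auto simp: dmr\<^sub>0_def lie_series_ge_def)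
  have lie_q: "?q \<in> lie_series" "?p \<in> lie_series"
    by (intro lie_series_subst_xy linear_form_xyz lie_polys.var lie_poly_z lie)+
  then have lie_E: "?E \<in> lie_series"
    by (intro lie_series_add lie_series_bracket linear_form_xyz lie_polys.var)
  show "coeff ?E w = coeff 0 w"
  proof (cases "length w \<ge> 4")
    case False
    \<comment> \<open>\<open>\<psi>\<close> starts in degree three, so the brackets start in degree
      four.\<close>
    have 0: "coeff (subst_xy s t \<psi>) v = 0" if "length v < 3" for s t :: "(xy, 'k) ncfps" and v
      unfolding coeff_subst_xy using that small by (intro sum.neutral) auto
    have "coeff (subst_xy s t \<psi> * var a) w = 0" for s t :: "(xy, 'k) ncfps" and a
      using False 0 by (cases w rule: rev_cases) auto
    moreover have "coeff (var a * subst_xy s t \<psi>) w = 0" for s t :: "(xy, 'k) ncfps" and a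
      using False 0 by (cases w) auto
    ultimately show ?thesis by (simp add: lie_bracket_def)
  next
    case True
    define n where "n = length w - 2"
    have n: "length w = n + 2" using True by (simp add: n_def)
    obtain c where c: "(\<Sum>q | length q = n. smult (coeff \<psi> (q @ [LY]))
        (word_eval x_ser y_ser q - smult ((- 1) ^ n) (word_eval z_ser y_ser (rev q))))
      = smult c (y_ser ^ n)"
      using dmr\<^sub>0_right_part_y[OF assms] .
    note c0 = const_term_linear_form[OF linear_form_xyz(1)]
      const_term_linear_form[OF linear_form_xyz(3)]
    \<comment> \<open>The substitution exchanges \<open>y\<close> and \<open>z\<close>, so the
      letter \<open>y\<close> now plays the part of \<open>z\<close>, and the multiple of
      \<open>y^n\<close> becomes one of \<open>z^n\<close>, with all coefficients equal.\<close>
    have "subst_xy x_ser z_ser (y_ser ^ n) = (z_ser ^ n :: (xy, 'k) ncfps)"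
      using subst_xy_word_eval[OF c0, of x_ser y_ser "replicate n LY"]
      by (simp add: word_eval_replicate subst_xy_var[OF c0])
    then have "(\<Sum>q | length q = n. smult (coeff \<psi> (q @ [LY]))
        (word_eval x_ser z_ser q - smult ((- 1) ^ n) (word_eval y_ser z_ser (rev q))))
      = smult c (z_ser ^ n)"
      using arg_cong[OF c, of "subst_xy x_ser z_ser"]
      by (simp add: subst_xy_sum subst_xy_smult subst_xy_diff subst_xy_word_eval[OF c0]
          subst_xy_minus subst_xy_var[OF c0])
    then have c': "(\<Sum>q | length q = n. coeff \<psi> (q @ [LY])
        * (coeff (word_eval x_ser z_ser q) u - (- 1) ^ n * coeff (word_eval y_ser z_ser (rev q)) u))
      = c * (- 1) ^ n" if "length u = n" for u
      by (drule_tac arg_cong[where f = "\<lambda>P. coeff P u"])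
        (simp only: coeff_sum coeff_smult coeff_simps coeff_z_power[OF that])
    have E: "coeff ?E (LX # u @ [LY]) = c * (- 1) ^ n" if u: "length u = n" for u
    proof -
      \<comment> \<open>Reversal moves the leading \<open>x\<close> to the end, where
        \<open>coeff_subst_xy_snoc\<close> with \<open>s = y\<close> leaves only the contribution of
        \<open>right_part LY \<psi>\<close>.\<close>
      have "coeff ?q (LX # u) = (- 1) ^ n * coeff ?q (rev u @ [LX])"
        using lie_series_rev[OF lie_q(1), of "rev u @ [LX]"] u by simp
      also have "coeff ?q (rev u @ [LX]) = - coeff (subst_xy y_ser z_ser (right_part LY \<psi>)) (rev u)"
        by (subst coeff_subst_xy_snoc) simp_all
      also have "\<dots> = - (\<Sum>q | length q = n. coeff \<psi> (q @ [LY])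
          * coeff (word_eval y_ser z_ser (rev q)) u)"
        by (simp add: coeff_subst_xy_linear linear_form_xyz coeff_word_eval_rev u)
      finally have q: "coeff ?q (LX # u) = - ((- 1) ^ n
          * (\<Sum>q | length q = n. coeff \<psi> (q @ [LY]) * coeff (word_eval y_ser z_ser (rev q)) u))"
        by simp
      have p: "coeff ?p (u @ [LY]) = - (\<Sum>q | length q = n. coeff \<psi> (q @ [LY])
          * coeff (word_eval x_ser z_ser q) u)"
        by (subst coeff_subst_xy_snoc) (simp_all add: coeff_subst_xy_linear linear_form_xyz u)
      \<comment> \<open>Of the four products in \<open>?E\<close>, \<open>?p x\<close> ends in
        \<open>x\<close> and \<open>y ?q\<close> starts with \<open>y\<close>; only the other two
        contain words \<open>x...y\<close>.\<close>
      have "coeff ?E (LX # u @ [LY]) = coeff ?q (LX # u) - coeff ?p (u @ [LY])"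
        using coeff_mult_var_snoc[of ?q LY "LX # u" LY] coeff_mult_var_snoc[of ?p LX "LX # u" LY]
        by (simp add: lie_bracket_def)
      also have "\<dots> = c * (- 1) ^ n"
        unfolding p q c'[OF u, symmetric]
        by (simp add: right_diff_distrib sum_subtractf sum_distrib_left mult_ac)
      finally show ?thesis .
    qed
    have "coeff (hom_part (length w) ?E) w = 0"
    proof (rule lie_poly_const_coeff_eq_0[where n = "length w" and c = "c * (- 1) ^ n"])
      show "hom_part (length w) ?E \<in> lie_polys" using lie_E by (simp add: lie_series_def)
      show "coeff (hom_part (length w) ?E) (LX # u @ [LY]) = c * (- 1) ^ n"
        if "length u + 2 = length w" for u
        using that n by (subst coeff_hom_part, subst E) simp_all
    qed (use True in simp_all)
    then show ?thesis by simp
  qed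
qed

theorem theorem1p4:
  fixes \<psi> :: "(xy, 'k::field_char_0) ncfps"
  assumes "\<psi> \<in> dmr\<^sub>0"
  shows "lie_bracket \<psi> x_ser
    + lie_bracket (subst_xy (- x_ser - y_ser) y_ser \<psi>) (- x_ser - y_ser) = 0"
proof -
  \<comment> \<open>This substitution is an involution exchanging \<open>y\<close> and
    \<open>z\<close>; it carries \<open>dmr\<^sub>0_bracket_identity\<close> back to the original
    variables.\<close>
  let ?r = "subst_xy x_ser z_ser :: (xy, 'k) ncfps \<Rightarrow> _"
  note c0 = const_term_linear_form[OF linear_form_xyz(1)]
    const_term_linear_form[OF linear_form_xyz(3)]
  have r: "?r x_ser = x_ser" "?r y_ser = z_ser" "?r z_ser = y_ser"
    by (simp_all add: subst_xy_var[OF c0] subst_xy_diff subst_xy_minus)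
  have "?r (subst_xy x_ser z_ser \<psi>) = \<psi>"
    using subst_xy_subst_xy[OF c0 c0, of \<psi>] by (simp only: r subst_xy_vars)
  moreover have "?r (subst_xy y_ser z_ser \<psi>) = subst_xy z_ser y_ser \<psi>"
    using subst_xy_subst_xy[OF c0 _ c0(2), of y_ser \<psi>] by (simp only: r const_term_var)
  moreover have "?r 0 = 0" using subst_xy_diff[of x_ser z_ser 0 0] by simp
  ultimately show ?thesis
    using arg_cong[OF dmr\<^sub>0_bracket_identity[OF assms], of ?r]
    by (simp only: lie_bracket_def subst_xy_add subst_xy_diff subst_xy_mult[OF c0] r)
qed

end
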